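(* Assume that the environment $\omega$ has non-increasing correlations. Then $h_c(\beta)=-\beta$ for every $\beta>0$ if and only if there is infinite disorder, i.e. $\liminf_{n\to\infty}-\frac1n\log\mathbb P(\omega_1=+1,\ldots,\omega_n=+1)=0$.
   Context: Renewal process: $\tau=(\tau_i)_{i\ge 0}$ has law $\mathbf P$ (expectation $\mathbf E$), $\tau_0=0$, and the increments $(\tau_i-\tau_{i-1})_{i\ge1}$ are i.i.d. with values in $\mathbb N=\{1,2,\ldots\}$ and law $K(n):=\mathbf P(\tau_1=n)$. The renewal is recurrent, $\mathbf P(\tau_1=+\infty)=0$, and $K(n)=(1+o(1))\,c_K n^{-(1+\alpha)}$ as $n\to\infty$ for some $\alpha>0$, $\alpha\neq1$, and $c_K>0$. Set $\delta_n:=\mathbf 1_{\{n\in\{\tau_0,\tau_1,\ldots\}\}}$. Environment: $\omega=(\omega_i)_{i\ge0}$ is a stationary ergodic random sequence with values in $\{-1,+1\}$, with law $\mathbb P$ (independent of $\tau$), non-trivial in the sense that $\mathbb P(\omega_1=+1)>0$ and $\mathbb P(\omega_1=-1)>0$. Pinning model: for $h\in\mathbb R$, $\beta\ge0$, $Z_{N,h}^{\omega,\beta}:=\mathbf E\big[\exp\big(\sum_{n=1}^N(h+\beta\omega_n)\delta_n\big)\big]$. The quenched free energy $\mathtt F(\beta,h):=\lim_{N\to\infty}\frac1N\log Z_{N,h}^{\omega,\beta}$ exists and is $\mathbb P$-a.s. constant; $h\mapsto\mathtt F(\beta,h)$ is convex, non-negative and non-decreasing. The quenched critical point $h_c(\beta)$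 is such that $\mathtt F(\beta,h)>0$ if and only if $h>h_c(\beta)$. Non-increasing correlations: for a finite set of indices $\mathcal E=\{i_1,\ldots,i_n\}\subset\mathbb N$ let $\mathfrak F_{\mathcal E}:=\{\omega_{i_1}=+1,\ldots,\omega_{i_n}=+1\}$ and $\theta^l\mathcal E:=\{i+l:\ i\in\mathcal E\}$. Correlations are non-increasing if for every two finite sets of indices $\mathcal E_1,\mathcal E_2$ with $\max\mathcal E_1<\min\mathcal E_2$ one has $\mathbb P(\mathfrak F_{\mathcal E_1\cup\theta^{k+1}\mathcal E_2})\le\mathbb P(\mathfrak F_{\mathcal E_1\cup\theta^{k}\mathcal E_2})$ for all $k\ge0$. *)

theory Defs
  imports "HOL-Probability.Probability"
begin

text \<open>
  The renewal epochs are natural numbers, so the increments are finite everywhere: this is how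
  recurrence of the renewal (no mass of the inter-arrival law at infinity) is encoded.  The
  truncated subtraction below is the true one because the epochs are strictly increasing.
\<close>

definition renewal_process :: "'a measure \<Rightarrow> (nat \<Rightarrow> 'a \<Rightarrow> nat) \<Rightarrow> (nat \<Rightarrow> real) \<Rightarrow> bool" where
  "renewal_process M \<tau> K \<longleftrightarrow>
     prob_space M \<and>
     (\<forall>i. \<tau> i \<in> measurable M (count_space UNIV)) \<and>
     (\<forall>x\<in>space M. \<tau> 0 x = 0) \<and>
     (\<forall>i. \<forall>x\<in>space M. \<tau> i x < \<tau> (Suc i) x) \<and>
     prob_space.indep_vars M (\<lambda>_. count_space UNIV) (\<lambda>i x. \<tau> (Suc i) x - \<tau> i x) UNIV \<and>
     (\<forall>i n. measure M {x\<in>space M. \<tau> (Suc i) x - \<tau> i x = n} = K n)"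

definition stationary_ergodic :: "'b measure \<Rightarrow> (nat \<Rightarrow> 'b \<Rightarrow> real) \<Rightarrow> bool" where
  "stationary_ergodic P \<omega> \<longleftrightarrow>
     prob_space P \<and>
     (\<forall>i. \<omega> i \<in> borel_measurable P) \<and>
     distr P (\<Pi>\<^sub>M i\<in>(UNIV::nat set). borel) (\<lambda>y i. \<omega> (Suc i) y)
       = distr P (\<Pi>\<^sub>M i\<in>(UNIV::nat set). borel) (\<lambda>y i. \<omega> i y) \<and>
     (\<forall>A \<in> sets (\<Pi>\<^sub>M i\<in>(UNIV::nat set). (borel :: real measure)).
        {s. (\<lambda>i. s (Suc i)) \<in> A} = A \<longrightarrow>
        measure P {y\<in>space P. (\<lambda>i. \<omega> i y) \<in> A} \<in> {0, 1})"

definition all_plus :: "'b measure \<Rightarrow> (nat \<Rightarrow> 'b \<Rightarrow> real) \<Rightarrow> nat set \<Rightarrow> 'b set" where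
  "all_plus P \<omega> E = {y\<in>space P. \<forall>i\<in>E. \<omega> i y = 1}"

definition nonincreasing_correlations :: "'b measure \<Rightarrow> (nat \<Rightarrow> 'b \<Rightarrow> real) \<Rightarrow> bool" where
  "nonincreasing_correlations P \<omega> \<longleftrightarrow>
     (\<forall>E1 E2. finite E1 \<longrightarrow> finite E2 \<longrightarrow> E1 \<noteq> {} \<longrightarrow> E2 \<noteq> {} \<longrightarrow>
        E1 \<subseteq> {1..} \<longrightarrow> E2 \<subseteq> {1..} \<longrightarrow> Max E1 < Min E2 \<longrightarrow>
        (\<forall>k. measure P (all_plus P \<omega> (E1 \<union> (\<lambda>i. i + (k + 1)) ` E2))
              \<le> measure P (all_plus P \<omega> (E1 \<union> (\<lambda>i. i + k) ` E2))))"

definition partition_function ::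
    "'a measure \<Rightarrow> (nat \<Rightarrow> 'a \<Rightarrow> nat) \<Rightarrow> real \<Rightarrow> real \<Rightarrow> (nat \<Rightarrow> real) \<Rightarrow> nat \<Rightarrow> real" where
  "partition_function M \<tau> \<beta> h w N =
     (\<integral>x. exp (\<Sum>n=1..N. (h + \<beta> * w n) * indicator (range (\<lambda>i. \<tau> i x)) n) \<partial>M)"

definition free_energy ::
    "'a measure \<Rightarrow> (nat \<Rightarrow> 'a \<Rightarrow> nat) \<Rightarrow> 'b measure \<Rightarrow> (nat \<Rightarrow> 'b \<Rightarrow> real) \<Rightarrow> real \<Rightarrow> real \<Rightarrow> real" where
  "free_energy M \<tau> P \<omega> \<beta> h =
     (THE f. AE y in P.
        (\<lambda>N. ln (partition_function M \<tau> \<beta> h (\<lambda>i. \<omega> i y) N) / real N) \<longlonglongrightarrow> f)"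

definition critical_point ::
    "'a measure \<Rightarrow> (nat \<Rightarrow> 'a \<Rightarrow> nat) \<Rightarrow> 'b measure \<Rightarrow> (nat \<Rightarrow> 'b \<Rightarrow> real) \<Rightarrow> real \<Rightarrow> real" where
  "critical_point M \<tau> P \<omega> \<beta> = (THE hc. \<forall>h. free_energy M \<tau> P \<omega> \<beta> h > 0 \<longleftrightarrow> h > hc)"

text \<open>
  On the reals \<^term>\<open>ln 0 = 0\<close>, so a real-valued rate would wrongly report infinite disorder when
  long runs of \<open>+1\<close> have probability zero.  There the rate is \<^term>\<open>\<infinity> :: ereal\<close>.
\<close>

definition minus_log :: "real \<Rightarrow> ereal" where
  "minus_log p = (if p = 0 then \<infinity> else ereal (- ln p))"

definition infinite_disorder :: "'b measure \<Rightarrow> (nat \<Rightarrow> 'b \<Rightarrow> real) \<Rightarrow> bool" where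
  "infinite_disorder P \<omega> \<longleftrightarrow>
     liminf (\<lambda>n. minus_log (measure P (all_plus P \<omega> {1..n})) / ereal (real n)) = 0"

end

theory Submission
  imports Defs
begin

text \<open>
  The free energy exists because the partition function with a renewal forced at the endpoint,
  called pinned below, is supermultiplicative along the environment: its logarithm is a bounded
  superadditive process over the shift, so it grows linearly at a deterministic rate
  (\<open>superadditive_ergodic_theorem\<close>).  Since the inter-arrival law has polynomial tails, forcing a
  renewal at the end costs only a polynomial factor, and the free partition function has the same
  rate (\<open>ln_partition_function_tendsto\<close>).  The free energy is nondecreasing and \<open>1\<close>-Lipschitz
  in \<open>h\<close>, nonpositive for \<open>h \<le> - \<beta>\<close> and positive for large \<open>h\<close>; hence the set where it is
  positive is an open half-line, the critical point is well defined and at least \<open>- \<beta>\<close>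
  (\<open>critical_point_iff\<close>).

  Under infinite disorder take \<open>h = - \<beta> + e\<close>, so that a renewal at a \<open>+1\<close> earns \<open>e\<close>.  A
  recurrent renewal with any positive reward is localized (\<open>homogeneous_gain\<close>): inside a run of
  \<open>n\<close> consecutive \<open>+1\<close> it earns \<open>G n\<close> with \<open>G > 0\<close>.  Such runs have frequency
  \<open>p \<ge> exp (- \<delta> n)\<close> with \<open>\<delta>\<close> as small as desired, and a strategy that visits only the runs has
  to jump distances of order \<open>n / p\<close>, which costs about \<open>(1 + \<alpha>) ln (n / p)\<close> per jump, that
  is \<open>(1 + \<alpha>) \<delta> n\<close> up to a logarithm of \<open>n\<close>.  The gain wins and the free energy is positive
  (\<open>infinite_disorder_localizes\<close>).

  If there is no infinite disorder, \<open>n\<close> consecutive \<open>+1\<close> have probability at most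
  \<open>C \<rho> ^ n\<close> with \<open>\<rho> < 1\<close>.  Non-increasing correlations allow closing the gaps of any finite set
  \<open>E\<close>, so all spins in \<open>E\<close> are \<open>+1\<close> with probability at most \<open>C \<rho> ^ card E\<close>
  (\<open>plus_prob_prefix\<close>).  Near \<open>h = - \<beta>\<close> with \<open>\<beta>\<close> large, a renewal at a \<open>-1\<close> has a tiny
  weight and one at a \<open>+1\<close> has weight close to \<open>1\<close> but is paid for by a factor \<open>\<rho>\<close>: the
  averaged partition function stays bounded, the free energy is not positive slightly above \<open>- \<beta>\<close>,
  and the critical point is not \<open>- \<beta>\<close> (\<open>exponential_decay_shifts_critical_point\<close>).
\<close>

section \<open>A superadditive ergodic theorem\<close>

locale ergodic_system = prob_space Q for Q :: "'c measure" +
  fixes T :: "'c \<Rightarrow> 'c"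
  assumes T_measurable [measurable]: "T \<in> measurable Q Q"
    and T_preserving: "distr Q Q T = Q"
    and T_ergodic: "\<And>A. A \<in> sets Q \<Longrightarrow> T -` A \<inter> space Q = A \<Longrightarrow> prob A \<in> {0, 1}"
begin

lemma iterate_measurable [measurable]: "(T ^^ n) \<in> measurable Q Q"
  by (rule measurable_compose_n) measurable

lemma iterate_space: "x \<in> space Q \<Longrightarrow> (T ^^ n) x \<in> space Q"
  using measurable_space[OF iterate_measurable] by blast

lemma iterate_preserving: "distr Q Q (T ^^ n) = Q"
proof (induction n)
  case (Suc n)
  have "distr Q Q (T ^^ Suc n) = distr (distr Q Q (T ^^ n)) Q T"
    by (subst distr_distr) (auto simp: comp_def)
  then show ?case using Suc T_preserving by (simp add: comp_def)
qed (simp add: distr_id)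

lemma integral_iterate:
  fixes g :: "'c \<Rightarrow> real"
  assumes "g \<in> borel_measurable Q"
  shows "(\<integral>x. g ((T ^^ n) x) \<partial>Q) = (\<integral>x. g x \<partial>Q)"
  using integral_distr[OF iterate_measurable assms, of n] by (simp add: iterate_preserving)

lemma prob_iterate_vimage:
  assumes "A \<in> sets Q"
  shows "prob ((T ^^ n) -` A \<inter> space Q) = prob A"
  using measure_distr[OF iterate_measurable assms, of n] by (simp add: iterate_preserving)

text \<open>
  Events of a superadditive process are typically only subinvariant, and only under the iterates
  from some \<open>n0\<close> on.  The event that an orbit enters \<open>A\<close> infinitely often is exactly invariant, is
  contained in \<open>A\<close> by the hypothesis, and has at least the probability of \<open>A\<close> because the shift
  preserves the measure; so ergodicity applies to it.
\<close>
lemma zero_one_law: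
  assumes A [measurable]: "A \<in> sets Q"
    and pull: "\<And>n x. n \<ge> n0 \<Longrightarrow> x \<in> space Q \<Longrightarrow> (T ^^ n) x \<in> A \<Longrightarrow> x \<in> A"
  shows "prob A \<in> {0, 1}"
proof -
  define B where "B = {x \<in> space Q. \<forall>m. \<exists>n\<ge>m. (T ^^ n) x \<in> A}"
  define U where "U m = {x \<in> space Q. \<exists>n\<ge>m. (T ^^ n) x \<in> A}" for m
  have [measurable]: "B \<in> sets Q" "U m \<in> sets Q" for m
    unfolding B_def U_def by measurable
  have inv: "T -` B \<inter> space Q = B"
  proof (intro set_eqI iffI)
    fix x assume "x \<in> T -` B \<inter> space Q"
    then have x: "x \<in> space Q" and *: "\<forall>m. \<exists>n\<ge>m. (T ^^ n) (T x) \<in> A" by (auto simp: B_def)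
    have "\<exists>n\<ge>m. (T ^^ n) x \<in> A" for m
      using *[rule_format, of m] by (metis funpow_simps_right(2) comp_apply le_SucI)
    then show "x \<in> B" using x by (auto simp: B_def)
  next
    fix x assume "x \<in> B"
    then have x: "x \<in> space Q" and *: "\<forall>m. \<exists>n\<ge>m. (T ^^ n) x \<in> A" by (auto simp: B_def)
    have "\<exists>n\<ge>m. (T ^^ n) (T x) \<in> A" for m
    proof -
      obtain n where "n \<ge> Suc m" "(T ^^ n) x \<in> A" using * by blast
      then show ?thesis
        by (intro exI[of _ "n - 1"]) (cases n, auto simp: funpow_swap1)
    qed
    then show "x \<in> T -` B \<inter> space Q"
      using x iterate_space[of x 1] by (auto simp: B_def)
  qed
  have "B \<subseteq> A" using pull by (force simp: B_def)
  moreover have "prob A \<le> prob B"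
  proof -
    have dec: "decseq U" by (auto simp: decseq_def U_def) (meson order_trans)
    have rng: "range U \<subseteq> sets Q" using \<open>\<And>m. U m \<in> sets Q\<close> by blast
    have inter: "(\<Inter>m. U m) = B" by (auto simp: B_def U_def)
    have "(\<lambda>m. prob (U m)) \<longlonglongrightarrow> prob B"
      using finite_Lim_measure_decseq[OF rng dec] unfolding inter .
    moreover have "prob A \<le> prob (U m)" for m
    proof -
      have "(T ^^ m) -` A \<inter> space Q \<subseteq> U m" by (auto simp: U_def)
      then have "prob ((T ^^ m) -` A \<inter> space Q) \<le> prob (U m)" by (intro finite_measure_mono) auto
      then show ?thesis using prob_iterate_vimage[OF A, of m] by simp
    qed
    ultimately show ?thesis by (intro LIMSEQ_le_const) auto
  qed
  ultimately have "prob A = prob B"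
    using finite_measure_mono[of B A] A by fastforce
  then show ?thesis using T_ergodic[OF _ inv] by simp
qed

end

text \<open>
  Superadditivity is required only for blocks of length at least \<open>n0\<close>: pinned partition functions
  over short intervals may vanish when the inter-arrival law does not charge small integers.
\<close>
locale superadditive_process = ergodic_system Q T for Q :: "'c measure" and T +
  fixes X :: "nat \<Rightarrow> 'c \<Rightarrow> real" and n0 :: nat and C :: real
  assumes n0_pos: "n0 \<ge> 1"
    and X_measurable: "\<And>n. n \<ge> n0 \<Longrightarrow> X n \<in> borel_measurable Q"
    and X_bound: "\<And>n x. n \<ge> n0 \<Longrightarrow> x \<in> space Q \<Longrightarrow> \<bar>X n x\<bar> \<le> C * real n"
    and X_super: "\<And>m n x. m \<ge> n0 \<Longrightarrow> n \<ge> n0 \<Longrightarrow> x \<in> space Q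
        \<Longrightarrow> X m x + X n ((T ^^ m) x) \<le> X (m + n) x"
begin

lemma C_nonneg: "C \<ge> 0"
proof -
  obtain x where "x \<in> space Q" using not_empty by blast
  from X_bound[OF order_refl this] have "0 \<le> C * real n0" by linarith
  then show ?thesis using n0_pos by (simp add: zero_le_mult_iff)
qed

lemma X_integrable: "n \<ge> n0 \<Longrightarrow> integrable Q (X n)"
  using X_bound by (intro integrable_const_bound[of _ "C * real n"] X_measurable) auto

text \<open>
  Katznelson and Weiss's greedy covering: from a good point, jump over an interval of length in
  \<open>{n0..L}\<close> on which the process has slope at least \<open>c\<close>; from a bad point, give up an interval of
  the minimal length \<open>n0\<close>, losing a fixed amount.  The remainder at the right end has length at
  most \<open>L + n0\<close> and costs a constant.
\<close>
lemma covering_bound: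
  fixes c :: real
  assumes L: "L \<ge> n0" and N: "N \<ge> n0" and x: "x \<in> space Q"
  defines "bad \<equiv> \<lambda>z. \<not> (\<exists>n\<in>{n0..L}. c * real n \<le> X n z)"
  shows "c * real N - (C + \<bar>c\<bar>) * real n0 * (\<Sum>i<N. of_bool (bad ((T ^^ i) x)))
      - (C + \<bar>c\<bar>) * real (L + n0) \<le> X N x"
  using N x
proof (induction N arbitrary: x rule: less_induct)
  case (less N)
  define D where "D = (C + \<bar>c\<bar>) * real n0"
  define D' where "D' = (C + \<bar>c\<bar>) * real (L + n0)"
  define g where "g z = (of_bool (bad z) :: real)" for z
  define S where "S N x = (\<Sum>i<N. g ((T ^^ i) x))" for N x
  have D0: "D \<ge> 0" using C_nonneg by (simp add: D_def)
  have S0: "S N x \<ge> 0" for N x unfolding S_def g_def by (intro sum_nonneg) auto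
  have S_split: "S N x = S n x + S (N - n) ((T ^^ n) x)" if "n \<le> N" for n
  proof -
    have "{..<N} = {..<n} \<union> (\<lambda>i. i + n) ` {..<N - n}"
    proof -
      have "i \<in> (\<lambda>i. i + n) ` {..<N - n}" if "i < N" "\<not> i < n" for i
        using that by (intro image_eqI[of _ _ "i - n"]) auto
      then show ?thesis using that by auto
    qed
    then have "S N x = S n x + (\<Sum>i\<in>(\<lambda>i. i + n) ` {..<N - n}. g ((T ^^ i) x))"
      unfolding S_def by (simp only:) (subst sum.union_disjoint, auto)
    then show ?thesis by (simp add: S_def sum.reindex funpow_add)
  qed
  have goal: "c * real N - D * S N x - D' \<le> X N x"
  proof (cases "N \<le> L + n0")
    case True
    have "c * real N - X N x \<le> \<bar>c\<bar> * real N + C * real N"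
      using X_bound[of N x] less.prems abs_ge_self[of c]
      by (smt (verit) mult_right_mono of_nat_0_le_iff)
    also have "\<dots> = (C + \<bar>c\<bar>) * real N" by (simp add: algebra_simps)
    also have "\<dots> \<le> D'"
      unfolding D'_def using True C_nonneg by (intro mult_left_mono) (simp_all only: of_nat_le_iff)
    finally show ?thesis using mult_nonneg_nonneg[OF D0 S0[of N x]] by linarith
  next
    case False
    show ?thesis
    proof (cases "bad x")
      case False
      then obtain n where n: "n0 \<le> n" "n \<le> L" "c * real n \<le> X n x" by (auto simp: bad_def)
      have "c * real (N - n) - D * S (N - n) ((T ^^ n) x) - D' \<le> X (N - n) ((T ^^ n) x)"
        using less.IH[of "N - n" "(T ^^ n) x"] n \<open>\<not> N \<le> L + n0\<close> n0_pos less.prems iterate_space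
        unfolding D_def S_def g_def D'_def by simp
      moreover have "X n x + X (N - n) ((T ^^ n) x) \<le> X N x"
        using X_super[of n "N - n" x] n \<open>\<not> N \<le> L + n0\<close> less.prems by simp
      moreover have "c * real N = c * real n + c * real (N - n)"
        using n \<open>\<not> N \<le> L + n0\<close> by (simp add: algebra_simps of_nat_diff)
      moreover have "D * S (N - n) ((T ^^ n) x) \<le> D * S N x"
        using S_split[of n] S0[of n x] D0 n \<open>\<not> N \<le> L + n0\<close> by (intro mult_left_mono) auto
      ultimately show ?thesis using n by linarith
    next
      case True
      have "c * real (N - n0) - D * S (N - n0) ((T ^^ n0) x) - D' \<le> X (N - n0) ((T ^^ n0) x)"
        using less.IH[of "N - n0" "(T ^^ n0) x"] \<open>\<not> N \<le> L + n0\<close> L n0_pos less.prems iterate_space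
        unfolding D_def S_def g_def D'_def by simp
      moreover have "X n0 x + X (N - n0) ((T ^^ n0) x) \<le> X N x"
        using X_super[of n0 "N - n0" x] L \<open>\<not> N \<le> L + n0\<close> less.prems by simp
      moreover have "c * real N = c * real n0 + c * real (N - n0)"
        using \<open>\<not> N \<le> L + n0\<close> by (simp add: algebra_simps of_nat_diff)
      moreover have "D * (1 + S (N - n0) ((T ^^ n0) x)) \<le> D * S N x"
      proof (intro mult_left_mono D0)
        have "1 = (\<Sum>i\<in>{0::nat}. g ((T ^^ i) x))" using True by (simp add: g_def)
        also have "\<dots> \<le> S n0 x" unfolding S_def using n0_pos by (intro sum_mono2) (auto simp: g_def)
        finally show "1 + S (N - n0) ((T ^^ n0) x) \<le> S N x"
          using S_split[of n0] \<open>\<not> N \<le> L + n0\<close> by simp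
      qed
      moreover have "c * real n0 - D \<le> X n0 x"
      proof -
        have "c * real n0 \<le> \<bar>c\<bar> * real n0" by (simp add: mult_right_mono)
        then show ?thesis
          using X_bound[of n0 x] less.prems unfolding D_def distrib_right by linarith
      qed
      ultimately show ?thesis unfolding distrib_left mult_1_right by linarith
    qed
  qed
  then show ?case unfolding D_def S_def g_def D'_def .
qed

text \<open>
  Integrate the covering bound: by invariance the expected number of bad points among the first \<open>N\<close>
  is \<open>N\<close> times the probability of being bad, which tends to \<open>0\<close> as \<open>L\<close> grows, while the cost per
  bad point does not depend on \<open>L\<close>.
\<close>
lemma le_mean_rate:
  assumes c: "AE x in Q. \<exists>n\<ge>n0. c * real n \<le> X n x"
    and f: "\<And>n. n \<ge> n0 \<Longrightarrow> expectation (X n) \<le> f * real n"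
  shows "c \<le> f"
proof -
  define D where "D = (C + \<bar>c\<bar>) * real n0"
  define B where "B L = {x \<in> space Q. \<not> (\<exists>n\<in>{n0..L}. c * real n \<le> X n x)}" for L
  have [measurable]: "B L \<in> sets Q" for L
  proof -
    have "{x \<in> space Q. c * real n \<le> X n x} \<in> sets Q" if "n \<ge> n0" for n
      using X_measurable[OF that] by measurable
    then have "space Q - (\<Union>n\<in>{n0..L}. {x \<in> space Q. c * real n \<le> X n x}) \<in> sets Q"
      by (intro sets.Diff sets.finite_UN) auto
    also have "space Q - (\<Union>n\<in>{n0..L}. {x \<in> space Q. c * real n \<le> X n x}) = B L"
      by (auto simp: B_def)
    finally show ?thesis .
  qed
  have main: "c - D * prob (B L) \<le> f" if L: "L \<ge> n0" for L
  proof -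
    define D' where "D' = (C + \<bar>c\<bar>) * real (L + n0)"
    have "c - D * prob (B L) - D' / real N \<le> f" if N: "N \<ge> n0" for N
    proof -
      have int: "integrable Q (\<lambda>x. indicator (B L) ((T ^^ i) x) :: real)" for i
        by (intro integrable_const_bound[of _ 1]) auto
      have "expectation (\<lambda>x. c * real N - D * (\<Sum>i<N. indicator (B L) ((T ^^ i) x)) - D')
          \<le> expectation (X N)"
      proof (rule integral_mono)
        show "integrable Q (\<lambda>x. c * real N - D * (\<Sum>i<N. indicator (B L) ((T ^^ i) x)) - D')"
          using int by auto
        show "integrable Q (X N)" using X_integrable N by simp
        fix x assume x: "x \<in> space Q"
        have "(\<Sum>i<N. indicator (B L) ((T ^^ i) x)) = (\<Sum>i<N.
            of_bool (\<not> (\<exists>n\<in>{n0..L}. c * real n \<le> X n ((T ^^ i) x))) :: real)"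
          using iterate_space[OF x] by (intro sum.cong refl) (auto simp: B_def indicator_def)
        then show "c * real N - D * (\<Sum>i<N. indicator (B L) ((T ^^ i) x)) - D' \<le> X N x"
          using covering_bound[OF L N x, of c] unfolding D_def D'_def by simp
      qed
      moreover have "expectation (\<lambda>x. \<Sum>i<N. indicator (B L) ((T ^^ i) x) :: real) = real N * prob (B L)"
      proof -
        have *: "expectation (\<lambda>x. indicator (B L) ((T ^^ i) x) :: real) = prob (B L)" for i
          using integral_iterate[of "indicator (B L)" i] by simp
        have "expectation (\<lambda>x. \<Sum>i<N. indicator (B L) ((T ^^ i) x) :: real)
            = (\<Sum>i<N. expectation (\<lambda>x. indicator (B L) ((T ^^ i) x) :: real))"
          by (rule Bochner_Integration.integral_sum) (rule int)
        also have "\<dots> = real N * prob (B L)" by (simp only: *) simp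
        finally show ?thesis .
      qed
      ultimately have "c * real N - D * (real N * prob (B L)) - D' \<le> f * real N"
        using f[OF N] int by (simp add: prob_space)
      then have "(c - D * prob (B L)) * real N - D' \<le> f * real N" by (simp add: algebra_simps)
      then show ?thesis using N n0_pos
        by (simp add: field_simps)
    qed
    moreover have "(\<lambda>N. c - D * prob (B L) - D' / real N) \<longlonglongrightarrow> c - D * prob (B L) - 0"
      by (intro tendsto_intros lim_const_over_n)
    ultimately show ?thesis by (intro LIMSEQ_le_const2) auto
  qed
  have "(\<lambda>L. prob (B L)) \<longlonglongrightarrow> prob (\<Inter>L. B L)"
  proof (rule finite_Lim_measure_decseq)
    show "range B \<subseteq> sets Q" using \<open>\<And>L. B L \<in> sets Q\<close> by blast
    show "decseq B" by (auto simp: decseq_def B_def)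
  qed
  moreover have "prob (\<Inter>L. B L) = 0"
  proof -
    have "AE x in Q. x \<notin> (\<Inter>L. B L)"
      using c by eventually_elim (simp add: B_def, meson atLeastAtMost_iff order_refl)
    moreover have "(\<Inter>L. B L) \<in> sets Q" by auto
    ultimately show ?thesis by (simp add: prob_eq_0)
  qed
  ultimately have "(\<lambda>L. c - D * prob (B L)) \<longlonglongrightarrow> c - D * 0"
    by (intro tendsto_intros) auto
  with main show ?thesis by (intro LIMSEQ_le_const2[of "\<lambda>L. c - D * prob (B L)"]) auto
qed

text \<open>
  The event that the slopes exceed a level strictly above \<open>f\<close> infinitely often obeys the zero-one
  law, and it cannot have probability one by \<open>le_mean_rate\<close>.
\<close>
lemma eventually_le_rate:
  assumes f: "\<And>n. n \<ge> n0 \<Longrightarrow> expectation (X n) \<le> f * real n" and "e > 0"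
  shows "AE x in Q. eventually (\<lambda>n. X n x \<le> (f + e) * real n) sequentially"
proof -
  \<comment> \<open>The slack \<open>1 / Suc k\<close> absorbs the effect of a shift, so that the event is exactly
    subinvariant.\<close>
  define A where "A = {x \<in> space Q. \<exists>k. \<forall>m. \<exists>n\<ge>m. n \<ge> n0 \<and>
      (f + e / 2 + 1 / real (Suc k)) * real n < X n x}"
  have A_sets [measurable]: "A \<in> sets Q"
  proof -
    have base: "{x \<in> space Q. n \<ge> n0 \<and> d < X n x} \<in> sets Q" for n d
    proof (cases "n \<ge> n0")
      case True then show ?thesis using X_measurable[OF True] by simp
    qed simp
    show ?thesis unfolding A_def
      by (intro sets.sets_Collect_countable_Ex sets.sets_Collect_countable_All
          sets.sets_Collect_conj sets.sets_Collect_const base)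
  qed
  have "prob A \<in> {0, 1}"
  proof (rule zero_one_law[OF A_sets, of n0])
    fix j x assume j: "j \<ge> n0" and x: "x \<in> space Q" and "(T ^^ j) x \<in> A"
    then obtain k where k: "\<And>m. \<exists>n\<ge>m. n \<ge> n0 \<and>
        (f + e / 2 + 1 / real (Suc k)) * real n < X n ((T ^^ j) x)"
      by (auto simp: A_def)
    define a where "a = f + e / 2 + 1 / real (Suc k)"
    define a' where "a' = f + e / 2 + 1 / real (Suc (Suc k))"
    have aa': "a' < a" unfolding a_def a'_def by (intro add_strict_left_mono frac_less2) auto
    have "\<exists>n\<ge>m. n \<ge> n0 \<and> a' * real n < X n x" for m
    proof -
      obtain m' where m': "real m' * (a - a') \<ge> C * real j + \<bar>a'\<bar> * real j"
        using reals_Archimedean3[of "a - a'"] aa' by (metis diff_gt_0_iff_gt less_imp_le)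
      obtain n where n: "n \<ge> max m m'" "n \<ge> n0" "a * real n < X n ((T ^^ j) x)"
        using k[of "max m m'"] by (auto simp: a_def)
      have "a' * real (j + n) = a' * real j + a' * real n" by (simp add: algebra_simps)
      also have "\<dots> \<le> \<bar>a'\<bar> * real j + a' * real n" by (simp add: mult_right_mono)
      also have "\<dots> \<le> a * real n - C * real j"
      proof -
        have "real m' * (a - a') \<le> real n * (a - a')" using n aa' by (intro mult_right_mono) auto
        then show ?thesis using m' by (simp add: algebra_simps)
      qed
      also have "\<dots> < X n ((T ^^ j) x) + X j x" using n X_bound[OF j x] by linarith
      also have "\<dots> \<le> X (j + n) x" using X_super[OF j n(2) x] by linarith
      finally show ?thesis using n by (intro exI[of _ "j + n"]) auto
    qed
    then show "x \<in> A" using x unfolding A_def a'_def by blast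
  qed
  moreover have "prob A \<noteq> 1"
  proof
    assume "prob A = 1"
    then have "AE x in Q. x \<in> A" by (simp add: prob_eq_1)
    then have "AE x in Q. \<exists>n\<ge>n0. (f + e / 2) * real n \<le> X n x"
    proof eventually_elim
      case (elim x)
      then obtain k n where n: "n \<ge> n0" "(f + e / 2 + 1 / real (Suc k)) * real n < X n x"
        by (auto simp: A_def)
      have "(f + e / 2) * real n \<le> (f + e / 2 + 1 / real (Suc k)) * real n"
        by (intro mult_right_mono) auto
      then show ?case using n by (intro exI[of _ n]) auto
    qed
    from le_mean_rate[OF this f] \<open>e > 0\<close> show False by simp
  qed
  ultimately have "AE x in Q. x \<notin> A" using prob_eq_0 by auto
  then show ?thesis
  proof (rule AE_mp, intro AE_I2 impI)
    fix x assume x: "x \<in> space Q" and "x \<notin> A"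
    obtain k where k: "1 / real (Suc k) < e / 2"
      using \<open>e > 0\<close> by (metis nat_approx_posE half_gt_zero)
    from x \<open>x \<notin> A\<close> obtain m where m: "\<And>n. n \<ge> m \<Longrightarrow> n \<ge> n0 \<Longrightarrow>
        X n x \<le> (f + e / 2 + 1 / real (Suc k)) * real n"
      unfolding A_def by (force simp: not_less)
    show "eventually (\<lambda>n. X n x \<le> (f + e) * real n) sequentially"
    proof (rule eventually_sequentiallyI[of "max m n0"])
      fix n assume "n \<ge> max m n0"
      then have "X n x \<le> (f + e / 2 + 1 / real (Suc k)) * real n" using m by auto
      also have "\<dots> \<le> (f + e) * real n" using k by (intro mult_right_mono) auto
      finally show "X n x \<le> (f + e) * real n" .
    qed
  qed
qed

end

context ergodic_system
begin

lemma birkhoff_eventually_le: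
  assumes g [measurable]: "g \<in> borel_measurable Q"
    and C: "\<And>x. x \<in> space Q \<Longrightarrow> \<bar>g x\<bar> \<le> C" and "e > 0"
  shows "AE x in Q. eventually (\<lambda>n. (\<Sum>i<n. g ((T ^^ i) x)) \<le> (expectation g + e) * real n) sequentially"
proof -
  interpret S: superadditive_process Q T "\<lambda>n x. \<Sum>i<n. g ((T ^^ i) x)" 1 C
  proof unfold_locales
    fix n :: nat and x assume "n \<ge> 1" and x: "x \<in> space Q"
    have "\<bar>\<Sum>i<n. g ((T ^^ i) x)\<bar> \<le> (\<Sum>i<n. C)"
      by (intro sum_abs[THEN order_trans] sum_mono C iterate_space x)
    then show "\<bar>\<Sum>i<n. g ((T ^^ i) x)\<bar> \<le> C * real n" by (simp add: mult.commute)
  next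
    fix m n :: nat and x
    have "(\<Sum>i<m + n. g ((T ^^ i) x)) = (\<Sum>i<m. g ((T ^^ i) x)) + (\<Sum>i<n. g ((T ^^ (i + m)) x))"
      by (induction n) (simp_all add: add.commute)
    then show "(\<Sum>i<m. g ((T ^^ i) x)) + (\<Sum>i<n. g ((T ^^ i) ((T ^^ m) x)))
        \<le> (\<Sum>i<m + n. g ((T ^^ i) x))"
      by (simp add: funpow_add)
  qed auto
  have int: "integrable Q (\<lambda>x. g ((T ^^ i) x))" for i
    by (intro integrable_const_bound[of _ C]) (auto intro!: AE_I2 C iterate_space)
  have "expectation (\<lambda>x. \<Sum>i<n. g ((T ^^ i) x)) = expectation g * real n" for n
    using integral_iterate[OF g] int by (simp add: Bochner_Integration.integral_sum)
  then show ?thesis using S.eventually_le_rate[OF _ \<open>e > 0\<close>, of "expectation g"] by simp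
qed

text \<open>
  Birkhoff sums and their negatives are both superadditive, so the upper bound applies on both
  sides.
\<close>
theorem birkhoff_bounded:
  assumes g [measurable]: "g \<in> borel_measurable Q"
    and C: "\<And>x. x \<in> space Q \<Longrightarrow> \<bar>g x\<bar> \<le> C"
  shows "AE x in Q. (\<lambda>n. (\<Sum>i<n. g ((T ^^ i) x)) / real n) \<longlonglongrightarrow> expectation g"
proof -
  have "AE x in Q. \<forall>k. eventually (\<lambda>n. (\<Sum>i<n. g ((T ^^ i) x))
      \<le> (expectation g + 1 / real (Suc k)) * real n) sequentially"
    by (subst AE_all_countable) (intro allI birkhoff_eventually_le[OF g C], auto)
  moreover have "AE x in Q. \<forall>k. eventually (\<lambda>n. (\<Sum>i<n. - g ((T ^^ i) x))
      \<le> (- expectation g + 1 / real (Suc k)) * real n) sequentially"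
    using birkhoff_eventually_le[of "\<lambda>x. - g x" C] C
    by (subst AE_all_countable) (intro allI, auto)
  ultimately show ?thesis
  proof eventually_elim
    case (elim x)
    define S where "S n = (\<Sum>i<n. g ((T ^^ i) x))" for n
    show ?case
      unfolding S_def[symmetric]
    proof (rule LIMSEQ_I)
      fix r :: real assume "r > 0"
      then obtain k where k: "1 / real (Suc k) < r" by (metis nat_approx_posE)
      have "eventually (\<lambda>n. S n \<le> (expectation g + 1 / real (Suc k)) * real n) sequentially"
        using elim(1) by (simp add: S_def)
      moreover have "eventually (\<lambda>n. - S n \<le> (- expectation g + 1 / real (Suc k)) * real n) sequentially"
        using elim(2)[rule_format, of k] by (simp only: S_def sum_negf)
      ultimately have "eventually (\<lambda>n. norm (S n / real n - expectation g) < r) sequentially"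
        using eventually_gt_at_top[of 0]
      proof eventually_elim
        case (elim n)
        have "S n / real n \<le> expectation g + 1 / real (Suc k)"
          using elim by (simp add: pos_divide_le_eq)
        moreover have "- (S n / real n) \<le> - expectation g + 1 / real (Suc k)"
          using elim by (simp add: pos_divide_le_eq minus_divide_left del: minus_divide_left[symmetric])
        ultimately show ?case using k by (simp add: abs_if)
      qed
      then show "\<exists>no. \<forall>n\<ge>no. norm (S n / real n - expectation g) < r"
        by (simp add: eventually_sequentially)
    qed
  qed
qed

end

context superadditive_process
begin

lemma X_blocks:
  assumes "m \<ge> n0" "r \<ge> n0" "x \<in> space Q"
  shows "(\<Sum>i<J. X m ((T ^^ (i * m)) x)) + X r ((T ^^ (J * m)) x) \<le> X (J * m + r) x"
  using assms(3)
proof (induction J arbitrary: x)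
  case (Suc J)
  have "(\<Sum>i<J. X m ((T ^^ (i * m)) ((T ^^ m) x))) + X r ((T ^^ (J * m)) ((T ^^ m) x))
      \<le> X (J * m + r) ((T ^^ m) x)"
    by (intro Suc.IH iterate_space Suc.prems)
  moreover have "X m x + X (J * m + r) ((T ^^ m) x) \<le> X (m + (J * m + r)) x"
    using assms Suc.prems by (intro X_super) auto
  moreover have "(T ^^ a) ((T ^^ m) x) = (T ^^ (m + a)) x" for a
    by (metis add.commute comp_apply funpow_add)
  ultimately show ?case by (simp add: sum.lessThan_Suc_shift add_ac del: sum.lessThan_Suc)
qed simp

text \<open>
  For each residue \<open>r < m\<close>, cut the interval into blocks of length \<open>m\<close> starting at \<open>n0 + r\<close>, with a
  first and a last piece of length between \<open>n0\<close> and \<open>2 * (n0 + m)\<close>; summing over \<open>r\<close> turns the block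
  sums into one sum along the orbit of the shift itself.  (The \<open>m\<close>-th iterate of an ergodic
  shift need not be ergodic.)
\<close>
lemma block_average_bound:
  assumes m: "m \<ge> n0" and N: "N \<ge> 2 * n0 + m" and x: "x \<in> space Q"
  shows "(\<Sum>i<N. X m ((T ^^ i) x)) - 5 * C * real m * real (n0 + m) \<le> real m * X N x"
proof -
  define a where "a i = X m ((T ^^ i) x)" for i
  define J where "J = (N - 2 * n0 - m) div m"
  have mpos: "m > 0" using m n0_pos by simp
  have J1: "J * m + 2 * n0 + m \<le> N" unfolding J_def
    using N by (metis Nat.le_diff_conv2 add.commute add.left_commute div_times_less_eq_dividend diff_diff_left)
  have J2: "N < J * m + 2 * n0 + 2 * m"
  proof -
    have "N - 2 * n0 - m < J * m + m" unfolding J_def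
      using mpos by (metis add.commute dividend_less_div_times mult.commute)
    then show ?thesis by simp
  qed
  have a_bd: "\<bar>a i\<bar> \<le> C * real m" for i
    unfolding a_def using m x by (intro X_bound iterate_space)
  have each: "(\<Sum>i<J. a (n0 + (i * m + r))) - 3 * C * real (n0 + m) \<le> X N x" if r: "r < m" for r
  proof -
    define s where "s = N - (n0 + r) - J * m"
    have s: "s \<ge> n0" "s \<le> 2 * n0 + 2 * m" "N = (n0 + r) + (J * m + s)"
      using J1 J2 r by (auto simp: s_def)
    have "- (C * real (n0 + m)) \<le> X (n0 + r) x"
    proof -
      have "C * real (n0 + r) \<le> C * real (n0 + m)" using r C_nonneg by (intro mult_left_mono) auto
      then show ?thesis using X_bound[of "n0 + r" x] x by linarith
    qed
    moreover have "- (2 * C * real (n0 + m)) \<le> X s ((T ^^ (J * m)) ((T ^^ (n0 + r)) x))"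
    proof -
      have "C * real s \<le> C * real (2 * n0 + 2 * m)" using s C_nonneg by (intro mult_left_mono) linarith+
      then show ?thesis using X_bound[OF s(1) iterate_space[OF iterate_space[OF x]], of "J * m" "n0 + r"]
        by (simp add: algebra_simps)
    qed
    moreover have "(\<Sum>i<J. a (n0 + (i * m + r))) + X s ((T ^^ (J * m)) ((T ^^ (n0 + r)) x))
        \<le> X (J * m + s) ((T ^^ (n0 + r)) x)"
    proof -
      have "(T ^^ (i * m)) ((T ^^ (n0 + r)) x) = (T ^^ (n0 + (i * m + r))) x" for i
        by (metis add.assoc add.commute comp_apply funpow_add)
      then show ?thesis
        using X_blocks[OF m s(1) iterate_space[OF x, of "n0 + r"], of J] unfolding a_def by simp
    qed
    moreover have "X (n0 + r) x + X (J * m + s) ((T ^^ (n0 + r)) x) \<le> X N x"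
      unfolding s(3) using s(1) x by (intro X_super) auto
    ultimately show ?thesis by linarith
  qed
  have "(\<Sum>r<m. (\<Sum>i<J. a (n0 + (i * m + r))) - 3 * C * real (n0 + m)) \<le> (\<Sum>r<m. X N x)"
    using each by (intro sum_mono) auto
  then have "(\<Sum>r<m. \<Sum>i<J. a (n0 + (i * m + r))) - real m * (3 * C * real (n0 + m)) \<le> real m * X N x"
    by (simp add: sum_subtractf)
  moreover have "(\<Sum>r<m. \<Sum>i<J. a (n0 + (i * m + r))) = (\<Sum>j\<in>{n0..<n0 + J * m}. a j)"
  proof -
    have "(\<Sum>r<m. \<Sum>i<J. a (n0 + (i * m + r))) = (\<Sum>i<J. \<Sum>r<m. a (n0 + (i * m + r)))"
      by (rule sum.swap)
    also have "\<dots> = (\<Sum>i<J. \<Sum>j = i * m..<i * m + m. a (n0 + j))"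
    proof (intro sum.cong[OF refl])
      fix i
      show "(\<Sum>r<m. a (n0 + (i * m + r))) = (\<Sum>j = i * m..<i * m + m. a (n0 + j))"
        by (rule sum.reindex_bij_witness[of _ "\<lambda>j. j - i * m" "\<lambda>r. i * m + r"]) auto
    qed
    also have "\<dots> = (\<Sum>j<J * m. a (n0 + j))" by (rule sum.nat_group)
    also have "\<dots> = (\<Sum>j\<in>{n0..<n0 + J * m}. a j)"
      by (rule sum.reindex_bij_witness[of _ "\<lambda>j. j - n0" "\<lambda>j. n0 + j"]) auto
    finally show ?thesis .
  qed
  moreover have "(\<Sum>j<N. a j) - real m * (2 * C * real (n0 + m)) \<le> (\<Sum>j\<in>{n0..<n0 + J * m}. a j)"
  proof -
    have sub: "{n0..<n0 + J * m} \<subseteq> {..<N}" using J1 by auto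
    have "(\<Sum>j<N. a j) = (\<Sum>j\<in>{..<N} - {n0..<n0 + J * m}. a j) + (\<Sum>j\<in>{n0..<n0 + J * m}. a j)"
      by (rule sum.subset_diff[OF sub]) simp
    moreover have "(\<Sum>j\<in>{..<N} - {n0..<n0 + J * m}. a j)
        \<le> real (card ({..<N} - {n0..<n0 + J * m})) * (C * real m)"
      using a_bd by (intro sum_bounded_above) (auto simp: abs_le_iff)
    moreover have "real (card ({..<N} - {n0..<n0 + J * m})) * (C * real m)
        \<le> real (2 * n0 + 2 * m) * (C * real m)"
      using J2 sub C_nonneg by (intro mult_right_mono) (simp_all add: card_Diff_subset)
    ultimately show ?thesis by (simp add: algebra_simps)
  qed
  ultimately show ?thesis unfolding a_def by (simp add: algebra_simps)
qed

text \<open>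
  A bounded form of Kingman's theorem: the upper bound is \<open>eventually_le_rate\<close>, and the lower bound
  comes from comparing with Birkhoff averages of a single \<open>X m\<close> of nearly optimal slope.
\<close>
theorem superadditive_ergodic_theorem:
  "\<exists>f. AE x in Q. (\<lambda>n. X n x / real n) \<longlonglongrightarrow> f"
proof -
  define R where "R n = expectation (X n) / real n" for n
  have R_le: "R n \<le> C" if "n \<ge> n0" for n
  proof -
    have "expectation (X n) \<le> C * real n"
      using X_bound[OF that] by (intro integral_le_const X_integrable that AE_I2) (auto simp: abs_le_iff)
    then show ?thesis using that n0_pos unfolding R_def by (simp add: pos_divide_le_eq)
  qed
  define f where "f = (SUP n\<in>{n0..}. R n)"
  have bdd: "bdd_above (R ` {n0..})" using R_le by (intro bdd_aboveI2[of _ _ C]) auto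
  have f: "expectation (X n) \<le> f * real n" if "n \<ge> n0" for n
  proof -
    have "R n \<le> f" unfolding f_def using that by (intro cSUP_upper bdd) auto
    then show ?thesis using that n0_pos unfolding R_def by (simp add: pos_divide_le_eq)
  qed
  have up: "AE x in Q. \<forall>k. eventually (\<lambda>n. X n x \<le> (f + 1 / real (Suc k)) * real n) sequentially"
    by (subst AE_all_countable) (intro allI eventually_le_rate f, auto)
  have low: "AE x in Q. \<forall>m. m \<ge> n0 \<longrightarrow>
      (\<lambda>n. (\<Sum>i<n. X m ((T ^^ i) x)) / real n) \<longlonglongrightarrow> expectation (X m)"
  proof (subst AE_all_countable, intro allI)
    fix m
    show "AE x in Q. m \<ge> n0 \<longrightarrow> (\<lambda>n. (\<Sum>i<n. X m ((T ^^ i) x)) / real n) \<longlonglongrightarrow> expectation (X m)"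
    proof (cases "m \<ge> n0")
      case True
      then show ?thesis
        using birkhoff_bounded[OF X_measurable[OF True] X_bound[OF True]] by simp
    qed simp
  qed
  have "AE x in Q. (\<lambda>n. X n x / real n) \<longlonglongrightarrow> f"
    using up low AE_space
  proof eventually_elim
    case (elim x)
    show ?case
    proof (rule order_tendstoI)
      fix u assume "f < u"
      then obtain k where k: "1 / real (Suc k) < u - f" by (metis nat_approx_posE diff_gt_0_iff_gt)
      from elim(1)[rule_format, of k] eventually_gt_at_top[of 0]
      show "eventually (\<lambda>n. X n x / real n < u) sequentially"
      proof eventually_elim
        case (elim n)
        then have "X n x / real n \<le> f + 1 / real (Suc k)" by (simp add: pos_divide_le_eq)
        then show ?case using k by linarith
      qed
    next
      fix l assume "l < f"
      then obtain m where m: "m \<ge> n0" "l < R m"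
        unfolding f_def using less_cSUP_iff[OF _ bdd, of l] by auto
      have mpos: "real m > 0" using m n0_pos by simp
      define D where "D = 5 * C * real m * real (n0 + m)"
      have "(\<lambda>n. ((\<Sum>i<n. X m ((T ^^ i) x)) / real n - D / real n) / real m)
          \<longlonglongrightarrow> (expectation (X m) - 0) / real m"
        using elim(2) m mpos by (intro tendsto_intros lim_const_over_n) auto
      then have "eventually (\<lambda>n. l < ((\<Sum>i<n. X m ((T ^^ i) x)) / real n - D / real n) / real m) sequentially"
        using m by (intro order_tendstoD) (auto simp: R_def)
      then show "eventually (\<lambda>n. l < X n x / real n) sequentially"
        using eventually_ge_at_top[of "2 * n0 + m"]
      proof eventually_elim
        case (elim n)
        then have n: "real n > 0" using m n0_pos by simp
        have "(\<Sum>i<n. X m ((T ^^ i) x)) - D \<le> real m * X n x"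
          unfolding D_def using block_average_bound[OF m(1) elim(2) \<open>x \<in> space Q\<close>] .
        then have "((\<Sum>i<n. X m ((T ^^ i) x)) - D) / real m / real n \<le> X n x / real n"
          using mpos n by (intro divide_right_mono) (simp_all add: pos_divide_le_eq mult.commute)
        also have "((\<Sum>i<n. X m ((T ^^ i) x)) - D) / real m / real n
            = ((\<Sum>i<n. X m ((T ^^ i) x)) / real n - D / real n) / real m"
          by (simp add: diff_divide_distrib mult.commute)
        finally show ?case using elim(1) by linarith
      qed
    qed
  qed
  then show ?thesis by blast
qed

end

section \<open>Pinned partition functions\<close>

text \<open>
  The partition function over \<open>{1..N}\<close> restricted to renewals at \<open>N\<close>, with reward \<open>v n\<close> at a
  renewal \<open>n\<close>, decomposed according to the last renewal before \<open>N\<close>.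
\<close>
fun pinned :: "(nat \<Rightarrow> real) \<Rightarrow> (nat \<Rightarrow> real) \<Rightarrow> nat \<Rightarrow> real" where
  "pinned K v N = (if N = 0 then 1 else (\<Sum>l<N. pinned K v l * K (N - l)) * exp (v N))"

declare pinned.simps [simp del]

lemma pinned_0 [simp]: "pinned K v 0 = 1"
  by (simp add: pinned.simps)

lemma pinned_rec: "N > 0 \<Longrightarrow> pinned K v N = (\<Sum>l<N. pinned K v l * K (N - l)) * exp (v N)"
  by (subst pinned.simps) simp

locale renewal_law =
  fixes K :: "nat \<Rightarrow> real"
  assumes K_nonneg: "\<And>n. K n \<ge> 0"
    and K_sum_le: "\<And>n. (\<Sum>j\<le>n. K j) \<le> 1"
begin

abbreviation Z where "Z \<equiv> pinned K"

lemma Z_nonneg: "Z v N \<ge> 0"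
proof (induction N rule: less_induct)
  case (less N)
  then show ?case
    by (cases "N = 0") (auto simp: pinned_rec K_nonneg intro!: mult_nonneg_nonneg sum_nonneg)
qed

lemma K_sum_reflected_le: "(\<Sum>l<N. K (N - l)) \<le> 1"
proof -
  have "(\<Sum>l<N. K (N - l)) = (\<Sum>j\<in>{1..N}. K j)"
    by (rule sum.reindex_bij_witness[of _ "\<lambda>j. N - j" "\<lambda>l. N - l"]) auto
  also have "\<dots> \<le> (\<Sum>j\<le>N. K j)" by (intro sum_mono2) (auto simp: K_nonneg)
  finally show ?thesis using K_sum_le[of N] by linarith
qed

lemma Z_mono:
  assumes "\<And>n. n \<in> {1..N} \<Longrightarrow> v n \<le> v' n"
  shows "Z v N \<le> Z v' N"
  using assms
proof (induction N rule: less_induct)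
  case (less N)
  show ?case
  proof (cases "N = 0")
    case False
    have "(\<Sum>l<N. Z v l * K (N - l)) * exp (v N) \<le> (\<Sum>l<N. Z v' l * K (N - l)) * exp (v' N)"
      using less False
      by (intro mult_mono sum_mono sum_nonneg mult_nonneg_nonneg K_nonneg Z_nonneg order_refl) auto
    then show ?thesis using False by (simp add: pinned_rec)
  qed simp
qed

text \<open>
  A trajectory has at most \<open>N\<close> renewals in \<open>{1..N}\<close>, so lowering each reward by \<open>t\<close> costs at most
  \<open>t * N\<close>.
\<close>
lemma Z_lower_tilt:
  assumes "t \<ge> 0"
  shows "exp (- (t * real N)) * Z v N \<le> Z (\<lambda>n. v n - t) N"
proof (induction N rule: less_induct)
  case (less N)
  show ?case
  proof (cases "N = 0")
    case False
    have "exp (- (t * real N)) * Z v N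
        = (\<Sum>l<N. exp (- (t * real N)) * (Z v l * K (N - l))) * exp (v N)"
      using False by (simp add: pinned_rec sum_distrib_left)
    also have "\<dots> \<le> (\<Sum>l<N. exp (- t) * (Z (\<lambda>n. v n - t) l * K (N - l))) * exp (v N)"
    proof (intro mult_right_mono sum_mono)
      fix l assume l: "l \<in> {..<N}"
      have "t * real N \<ge> t + t * real l"
        using l assms mult_left_mono[of "1 + real l" "real N" t] by (simp add: algebra_simps)
      then have "exp (- (t * real N)) \<le> exp (- t) * exp (- (t * real l))"
        by (simp add: mult_exp_exp)
      then have "exp (- (t * real N)) * Z v l \<le> exp (- t) * (exp (- (t * real l)) * Z v l)"
        using mult_right_mono[OF _ Z_nonneg] by (simp only: mult.assoc[symmetric]) 
      also have "\<dots> \<le> exp (- t) * Z (\<lambda>n. v n - t) l"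
        using less[of l] l by (intro mult_left_mono) auto
      finally show "exp (- (t * real N)) * (Z v l * K (N - l))
          \<le> exp (- t) * (Z (\<lambda>n. v n - t) l * K (N - l))"
        using mult_right_mono[OF _ K_nonneg] by (simp only: mult.assoc[symmetric])
    qed simp
    also have "\<dots> = Z (\<lambda>n. v n - t) N"
      using False by (simp add: pinned_rec sum_distrib_left[symmetric] exp_diff exp_minus divide_inverse mult_ac)
    finally show ?thesis .
  qed simp
qed

text \<open>
  Keep only the trajectories that renew at \<open>m\<close>.
\<close>
lemma Z_supermult: "Z v m * Z (\<lambda>n. v (n + m)) n \<le> Z v (m + n)"
proof (induction n rule: less_induct)
  case (less n)
  show ?case
  proof (cases "n = 0")
    case False
    have "Z v m * Z (\<lambda>n. v (n + m)) n
        = (\<Sum>l<n. (Z v m * Z (\<lambda>n. v (n + m)) l) * K (n - l)) * exp (v (m + n))"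
      using False by (simp add: pinned_rec sum_distrib_left mult.assoc add.commute)
    also have "\<dots> \<le> (\<Sum>l<n. Z v (m + l) * K (n - l)) * exp (v (m + n))"
      using less by (intro mult_right_mono sum_mono K_nonneg) auto
    also have "(\<Sum>l<n. Z v (m + l) * K (n - l)) = (\<Sum>l\<in>{m..<m + n}. Z v l * K (m + n - l))"
      by (rule sum.reindex_bij_witness[of _ "\<lambda>l. l - m" "\<lambda>l. m + l"]) auto
    also have "\<dots> * exp (v (m + n)) \<le> (\<Sum>l<m + n. Z v l * K (m + n - l)) * exp (v (m + n))"
      by (intro mult_right_mono sum_mono2) (auto intro!: mult_nonneg_nonneg Z_nonneg K_nonneg)
    also have "\<dots> = Z v (m + n)" using False by (simp add: pinned_rec)
    finally show ?thesis .
  qed simp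
qed

lemma Z_jump:
  assumes "g \<ge> 1"
  shows "Z v m * (K g * exp (v (m + g))) \<le> Z v (m + g)"
proof -
  have "Z v m * K g \<le> (\<Sum>l<m + g. Z v l * K (m + g - l))"
    using member_le_sum[of m "{..<m + g}" "\<lambda>l. Z v l * K (m + g - l)"] assms
    by (auto intro!: mult_nonneg_nonneg Z_nonneg K_nonneg)
  then have "Z v m * K g * exp (v (m + g)) \<le> (\<Sum>l<m + g. Z v l * K (m + g - l)) * exp (v (m + g))"
    by (intro mult_right_mono) auto
  then show ?thesis using assms by (simp add: pinned_rec mult.assoc)
qed

lemma Z_upper:
  assumes "B \<ge> 0" "\<And>n. n \<in> {1..N} \<Longrightarrow> v n \<le> B"
  shows "Z v N \<le> exp (B * real N)"
  using assms(2)
proof (induction N rule: less_induct)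
  case (less N)
  show ?case
  proof (cases "N = 0")
    case False
    have "(\<Sum>l<N. Z v l * K (N - l)) \<le> (\<Sum>l<N. exp (B * (real N - 1)) * K (N - l))"
    proof (intro sum_mono mult_right_mono K_nonneg)
      fix l assume l: "l \<in> {..<N}"
      have "Z v l \<le> exp (B * real l)" using less l by auto
      also have "\<dots> \<le> exp (B * (real N - 1))"
        using l assms(1) by (simp add: mult_left_mono)
      finally show "Z v l \<le> exp (B * (real N - 1))" .
    qed
    also have "\<dots> = exp (B * (real N - 1)) * (\<Sum>l<N. K (N - l))" by (simp add: sum_distrib_left)
    also have "\<dots> \<le> exp (B * (real N - 1)) * 1"
      by (intro mult_left_mono K_sum_reflected_le) simp
    finally have "Z v N \<le> exp (B * (real N - 1)) * exp (v N)"
      using False by (simp add: pinned_rec)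
    also have "\<dots> \<le> exp (B * (real N - 1)) * exp B"
      using less.prems[of N] False by simp
    finally show ?thesis by (simp add: mult_exp_exp algebra_simps)
  qed simp
qed

lemma Z_power:
  "Z (\<lambda>_. c) m ^ k \<le> Z (\<lambda>_. c) (k * m)"
proof (induction k)
  case (Suc k)
  have "Z (\<lambda>_. c) m ^ Suc k \<le> Z (\<lambda>_. c) m * Z (\<lambda>_. c) (k * m)"
    using Suc Z_nonneg by (simp add: mult_left_mono)
  also have "\<dots> \<le> Z (\<lambda>_. c) (Suc k * m)" using Z_supermult[of "\<lambda>_. c" m "k * m"] by simp
  finally show ?case .
qed simp

end

locale renewal =
  fixes M :: "'a measure" and \<tau> :: "nat \<Rightarrow> 'a \<Rightarrow> nat" and K :: "nat \<Rightarrow> real"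
  assumes renewal: "renewal_process M \<tau> K"
begin

sublocale prob_space M
  using renewal by (simp add: renewal_process_def)

definition \<xi> :: "nat \<Rightarrow> 'a \<Rightarrow> nat" where "\<xi> i x = \<tau> (Suc i) x - \<tau> i x"

lemma \<tau>_measurable [measurable]: "\<tau> i \<in> measurable M (count_space UNIV)"
  and \<tau>_0: "x \<in> space M \<Longrightarrow> \<tau> 0 x = 0"
  and \<tau>_less: "x \<in> space M \<Longrightarrow> \<tau> i x < \<tau> (Suc i) x"
  and \<xi>_indep: "indep_vars (\<lambda>_. count_space UNIV) \<xi> UNIV"
  and \<xi>_law: "prob {x \<in> space M. \<xi> i x = n} = K n"
  using renewal unfolding renewal_process_def \<xi>_def[abs_def] by auto

lemma \<xi>_measurable [measurable]: "\<xi> i \<in> measurable M (count_space UNIV)"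
  using \<xi>_indep by (auto simp: indep_vars_def)

lemma \<tau>_eq_sum: "x \<in> space M \<Longrightarrow> \<tau> i x = (\<Sum>a<i. \<xi> a x)"
proof (induction i)
  case (Suc i)
  then have "\<tau> (Suc i) x = \<tau> i x + \<xi> i x" using \<tau>_less[of x i] by (simp add: \<xi>_def)
  then show ?case using Suc by simp
qed (simp add: \<tau>_0)

lemma \<tau>_strict_mono: "x \<in> space M \<Longrightarrow> i < j \<Longrightarrow> \<tau> i x < \<tau> j x"
  by (rule lift_Suc_mono_less[of "\<lambda>i. \<tau> i x"]) (auto intro: \<tau>_less)

lemma \<tau>_inj: "x \<in> space M \<Longrightarrow> inj (\<lambda>i. \<tau> i x)"
  by (intro strict_mono_imp_inj_on strict_monoI \<tau>_strict_mono)

lemma \<tau>_ge: "x \<in> space M \<Longrightarrow> i \<le> \<tau> i x"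
proof (induction i)
  case (Suc i)
  then show ?case using \<tau>_less[of x i] by simp
qed simp

lemma prob_\<xi>_le: "prob {x \<in> space M. \<xi> i x \<le> n} = (\<Sum>j\<le>n. K j)"
proof -
  have "prob (\<Union>j\<in>{..n}. {x \<in> space M. \<xi> i x = j}) = (\<Sum>j\<le>n. prob {x \<in> space M. \<xi> i x = j})"
    by (intro finite_measure_finite_Union) (auto simp: disjoint_family_on_def)
  also have "(\<Union>j\<in>{..n}. {x \<in> space M. \<xi> i x = j}) = {x \<in> space M. \<xi> i x \<le> n}" by auto
  finally show ?thesis by (simp add: \<xi>_law)
qed

sublocale renewal_law K
proof
  show "K n \<ge> 0" for n using \<xi>_law[of 0 n] by (metis measure_nonneg)
  show "(\<Sum>j\<le>n. K j) \<le> 1" for n using prob_\<xi>_le[of 0 n] by (metis prob_le_1)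
qed

lemma K_0: "K 0 = 0"
proof -
  have "K 0 = prob {x \<in> space M. \<xi> 0 x = 0}" by (rule \<xi>_law[symmetric])
  also have "{x \<in> space M. \<xi> 0 x = 0} = {}"
    using \<tau>_less[of _ 0] by (auto simp: \<xi>_def not_le[symmetric])
  finally show ?thesis by simp
qed

lemma K_sum_tendsto: "(\<lambda>n. \<Sum>j\<le>n. K j) \<longlonglongrightarrow> 1"
proof -
  have "(\<lambda>n. prob {x \<in> space M. \<xi> 0 x \<le> n}) \<longlonglongrightarrow> prob (\<Union>n. {x \<in> space M. \<xi> 0 x \<le> n})"
    by (intro finite_Lim_measure_incseq) (auto simp: incseq_def)
  moreover have "(\<Union>n. {x \<in> space M. \<xi> 0 x \<le> n}) = space M" by auto
  ultimately show ?thesis by (simp add: prob_\<xi>_le prob_space)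
qed

definition path_term :: "(nat \<Rightarrow> real) \<Rightarrow> nat \<Rightarrow> nat \<Rightarrow> 'a \<Rightarrow> real" where
  "path_term v i k x = exp (\<Sum>j\<in>{1..i}. v (\<tau> j x)) * of_bool (\<tau> i x = k)"

lemma path_term_measurable [measurable]: "path_term v i k \<in> borel_measurable M"
  unfolding path_term_def by measurable

lemma path_term_bounded:
  assumes "x \<in> space M"
  shows "\<bar>path_term v i k x\<bar> \<le> exp (\<Sum>n\<le>k. \<bar>v n\<bar>)"
proof (cases "\<tau> i x = k")
  case True
  have inj: "inj_on (\<lambda>j. \<tau> j x) {1..i}"
    using \<tau>_inj[OF assms] by (rule inj_on_subset) simp
  have "(\<Sum>j\<in>{1..i}. v (\<tau> j x)) \<le> (\<Sum>j\<in>{1..i}. \<bar>v (\<tau> j x)\<bar>)" by (intro sum_mono) auto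
  also have "\<dots> = (\<Sum>n\<in>(\<lambda>j. \<tau> j x) ` {1..i}. \<bar>v n\<bar>)" using inj by (simp add: sum.reindex)
  also have "\<dots> \<le> (\<Sum>n\<le>k. \<bar>v n\<bar>)"
    using True assms \<tau>_strict_mono[OF assms]
    by (intro sum_mono2) (auto simp: le_less elim!: le_neq_implies_less)
  finally show ?thesis by (simp add: path_term_def True)
qed (simp add: path_term_def)

lemma path_term_integrable: "integrable M (path_term v i k)"
  by (intro integrable_const_bound[of _ "exp (\<Sum>n\<le>k. \<bar>v n\<bar>)"])
     (auto intro!: AE_I2 path_term_bounded)

text \<open>
  The first \<open>i\<close> renewal epochs are sums of the increments before \<open>\<xi> i\<close>, which are independent of it.
\<close>
lemma path_term_indep:
  fixes g :: "nat \<Rightarrow> real"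
  assumes "\<And>n. \<bar>g n\<bar> \<le> 1"
  shows "expectation (\<lambda>x. path_term v i k x * g (\<xi> i x))
    = expectation (path_term v i k) * expectation (\<lambda>x. g (\<xi> i x))"
proof -
  define F where "F z = exp (\<Sum>j\<in>{1..i}. v (\<Sum>a<j. z a)) * of_bool ((\<Sum>a<i. z a) = k)"
    for z :: "nat \<Rightarrow> nat"
  define P where "P = (PiM {..<i} (\<lambda>_. count_space UNIV) :: (nat \<Rightarrow> nat) measure)"
  have partial: "(\<lambda>z. \<Sum>a<j. z a) \<in> measurable P (count_space UNIV)" if "j \<le> i" for j
    using that
  proof (induction j)
    case (Suc j)
    have comp: "(\<lambda>z. z j) \<in> measurable P (count_space UNIV)"
      unfolding P_def using Suc.prems by (intro measurable_component_singleton) auto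
    have part: "(\<lambda>z. \<Sum>a<j. z a) \<in> measurable P (count_space UNIV)" using Suc by simp
    have "(\<lambda>z. n + z j) \<in> measurable P (count_space UNIV)" for n
      using measurable_compose[OF comp, of "\<lambda>c. n + c" "count_space UNIV"] by simp
    from measurable_compose_countable[OF this part]
    show ?case unfolding sum.lessThan_Suc .
  qed simp
  have F_meas: "F \<in> borel_measurable P"
  proof -
    have "(\<lambda>z. v (\<Sum>a<j. z a)) \<in> borel_measurable P" if "j \<in> {1..i}" for j
      using that by (intro measurable_compose[OF partial]) auto
    then have "(\<lambda>z. \<Sum>j\<in>{1..i}. v (\<Sum>a<j. z a)) \<in> borel_measurable P" by (rule borel_measurable_sum)
    note measurable_compose[OF this borel_measurable_exp]
    moreover have "(\<lambda>z. of_bool ((\<Sum>a<i. z a) = k) :: real) \<in> borel_measurable P"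
      by (rule measurable_compose[OF partial[OF order_refl]]) simp
    ultimately show ?thesis unfolding F_def[abs_def] by (rule borel_measurable_times)
  qed
  have ind: "indep_var P (\<lambda>x. restrict (\<lambda>a. \<xi> a x) {..<i})
      (PiM {i} (\<lambda>_. count_space UNIV)) (\<lambda>x. restrict (\<lambda>a. \<xi> a x) {i})"
    unfolding P_def by (rule indep_var_restrict[OF \<xi>_indep]) auto
  have G_meas: "(\<lambda>z. g (z i)) \<in> borel_measurable (PiM {i} (\<lambda>_. count_space UNIV))"
    by (rule measurable_compose[OF measurable_component_singleton]) auto
  have "indep_var borel (F \<circ> (\<lambda>x. restrict (\<lambda>a. \<xi> a x) {..<i}))
      borel ((\<lambda>z. g (z i)) \<circ> (\<lambda>x. restrict (\<lambda>a. \<xi> a x) {i}))"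
    by (rule indep_var_compose[OF ind F_meas G_meas])
  then have "indep_var borel (\<lambda>x. F (restrict (\<lambda>a. \<xi> a x) {..<i})) borel (\<lambda>x. g (\<xi> i x))"
    by (simp add: comp_def)
  moreover have F_eq: "F (restrict (\<lambda>a. \<xi> a x) {..<i}) = path_term v i k x" if "x \<in> space M" for x
    using that by (simp add: F_def path_term_def \<tau>_eq_sum)
  moreover have "integrable M (\<lambda>x. F (restrict (\<lambda>a. \<xi> a x) {..<i}))"
    using path_term_integrable[of v i k] F_eq
    by (simp cong: Bochner_Integration.integrable_cong)
  moreover have "integrable M (\<lambda>x. g (\<xi> i x))"
    using assms by (intro integrable_const_bound[of _ 1]) auto
  ultimately have "expectation (\<lambda>x. F (restrict (\<lambda>a. \<xi> a x) {..<i}) * g (\<xi> i x))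
      = expectation (\<lambda>x. F (restrict (\<lambda>a. \<xi> a x) {..<i})) * expectation (\<lambda>x. g (\<xi> i x))"
    by (intro indep_var_lebesgue_integral)
  then show ?thesis using F_eq by (simp cong: Bochner_Integration.integral_cong)
qed

definition path_weight :: "(nat \<Rightarrow> real) \<Rightarrow> nat \<Rightarrow> nat \<Rightarrow> real" where
  "path_weight v i k = expectation (path_term v i k)"

lemma path_weight_0: "path_weight v 0 k = of_bool (k = 0)"
proof -
  have "path_weight v 0 k = expectation (\<lambda>x. of_bool (k = 0))"
    unfolding path_weight_def by (intro Bochner_Integration.integral_cong) (auto simp: path_term_def \<tau>_0)
  then show ?thesis by (simp add: prob_space)
qed

lemma path_weight_Suc: "path_weight v (Suc i) k = (\<Sum>l<k. path_weight v i l * K (k - l)) * exp (v k)"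
proof -
  have "path_weight v (Suc i) k
      = expectation (\<lambda>x. \<Sum>l<k. path_term v i l x * of_bool (\<xi> i x = k - l) * exp (v k))"
    unfolding path_weight_def
  proof (intro Bochner_Integration.integral_cong refl)
    fix x assume x: "x \<in> space M"
    show "path_term v (Suc i) k x = (\<Sum>l<k. path_term v i l x * of_bool (\<xi> i x = k - l) * exp (v k))"
    proof (cases "\<tau> (Suc i) x = k")
      case True
      have less: "\<tau> i x < k" using \<tau>_less[OF x, of i] True by simp
      have "(\<Sum>l<k. path_term v i l x * of_bool (\<xi> i x = k - l) * exp (v k))
          = (\<Sum>l<k. if l = \<tau> i x then path_term v i l x * exp (v k) else 0)"
        using True by (intro sum.cong refl) (auto simp: \<xi>_def path_term_def)
      also have "\<dots> = path_term v (Suc i) k x"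
        using less True by (simp add: path_term_def exp_add)
      finally show ?thesis by simp
    next
      case False
      then have "path_term v i l x * of_bool (\<xi> i x = k - l) = 0" if "l < k" for l
        using that \<tau>_less[OF x, of i] by (auto simp: path_term_def \<xi>_def)
      then have "(\<Sum>l<k. path_term v i l x * of_bool (\<xi> i x = k - l) * exp (v k)) = 0"
        by (intro sum.neutral ballI) simp
      then show ?thesis using False by (simp add: path_term_def)
    qed
  qed
  also have "\<dots> = (\<Sum>l<k. expectation (\<lambda>x. path_term v i l x * of_bool (\<xi> i x = k - l) * exp (v k)))"
  proof (intro Bochner_Integration.integral_sum integrable_mult_left)
    fix l
    show "integrable M (\<lambda>x. path_term v i l x * of_bool (\<xi> i x = k - l))"
      by (rule Bochner_Integration.integrable_bound[OF path_term_integrable[of v i l]])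
         (auto intro!: AE_I2)
  qed
  also have "\<dots> = (\<Sum>l<k. path_weight v i l * K (k - l) * exp (v k))"
  proof (intro sum.cong refl)
    fix l
    have "expectation (\<lambda>x. of_bool (\<xi> i x = k - l) :: real) = K (k - l)"
    proof -
      have "expectation (\<lambda>x. of_bool (\<xi> i x = k - l) :: real)
          = expectation (indicator {x \<in> space M. \<xi> i x = k - l})"
        by (intro Bochner_Integration.integral_cong) auto
      then show ?thesis by (simp add: \<xi>_law)
    qed
    then show "expectation (\<lambda>x. path_term v i l x * of_bool (\<xi> i x = k - l) * exp (v k))
        = path_weight v i l * K (k - l) * exp (v k)"
      using path_term_indep[of "\<lambda>n. of_bool (n = k - l)" v i l] by (simp add: path_weight_def)
  qed
  finally show ?thesis by (simp add: sum_distrib_right)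
qed

lemma path_weight_beyond: "k < i \<Longrightarrow> path_weight v i k = 0"
proof -
  assume "k < i"
  then have "path_weight v i k = expectation (\<lambda>x. 0)"
    unfolding path_weight_def
    by (intro Bochner_Integration.integral_cong refl) (auto simp: path_term_def, metis \<tau>_ge leD)
  then show ?thesis by simp
qed

lemma Z_eq_path_weights: "k \<le> N \<Longrightarrow> Z v k = (\<Sum>i\<le>N. path_weight v i k)"
proof (induction k arbitrary: N rule: less_induct)
  case (less k)
  show ?case
  proof (cases "k = 0")
    case True
    then show ?thesis
      by (cases N) (simp_all add: path_weight_0 path_weight_beyond sum.atMost_Suc_shift del: sum.atMost_Suc)
  next
    case False
    then obtain N' where N': "N = Suc N'" using less.prems by (cases N) auto
    have "(\<Sum>i\<le>N. path_weight v i k) = (\<Sum>i\<le>N'. path_weight v (Suc i) k)"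
      using False by (simp add: N' sum.atMost_Suc_shift path_weight_0 del: sum.atMost_Suc)
    also have "\<dots> = (\<Sum>l<k. (\<Sum>i\<le>N'. path_weight v i l) * K (k - l)) * exp (v k)"
      unfolding path_weight_Suc sum_distrib_right by (rule sum.swap)
    also have "\<dots> = (\<Sum>l<k. Z v l * K (k - l)) * exp (v k)"
    proof -
      have "(\<Sum>i\<le>N'. path_weight v i l) = Z v l" if "l < k" for l
        using less.IH[OF that, of N'] less.prems N' that by simp
      then show ?thesis by simp
    qed
    finally show ?thesis using False by (simp add: pinned_rec)
  qed
qed

definition survival :: "nat \<Rightarrow> real" where "survival m = 1 - (\<Sum>j\<le>m. K j)"

lemma survival_bounds: "0 \<le> survival m" "survival m \<le> 1"
  using K_sum_le[of m] K_nonneg by (auto simp: survival_def intro!: sum_nonneg)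

text \<open>
  Decompose according to the last renewal \<open>k\<close> in \<open>{0..N}\<close>; the next increment then exceeds
  \<open>N - k\<close>.
\<close>
lemma partition_function_eq:
  "partition_function M \<tau> \<beta> h w N = (\<Sum>k\<le>N. Z (\<lambda>n. h + \<beta> * w n) k * survival (N - k))"
proof -
  define v where "v n = h + \<beta> * w n" for n
  have "partition_function M \<tau> \<beta> h w N
      = expectation (\<lambda>x. \<Sum>k\<le>N. \<Sum>i\<le>N. path_term v i k x * of_bool (\<xi> i x > N - k))"
    unfolding partition_function_def v_def[symmetric]
  proof (intro Bochner_Integration.integral_cong refl)
    fix x assume x: "x \<in> space M"
    have bij: "inj (\<lambda>i. \<tau> i x)" by (rule \<tau>_inj[OF x])
    define I where "I = Max {i. \<tau> i x \<le> N}"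
    have fin: "finite {i. \<tau> i x \<le> N}"
      by (rule finite_subset[of _ "{..N}"]) (use \<tau>_ge[OF x] in \<open>auto intro: order_trans\<close>)
    have I: "\<tau> I x \<le> N" using Max_in[OF fin] \<tau>_0[OF x] unfolding I_def by (metis (mono_tags, lifting) empty_iff le0 mem_Collect_eq)
    have I_max: "i \<le> I" if "\<tau> i x \<le> N" for i using that fin unfolding I_def by simp
    have I_Suc: "\<tau> (Suc I) x > N" using I_max[of "Suc I"] by force
    have le_iff: "\<tau> i x \<le> N \<longleftrightarrow> i \<le> I" for i
      using I_max I \<tau>_strict_mono[OF x, of i I] by (cases "i = I") (auto simp: le_less)
    have "(\<Sum>n=1..N. v n * indicator (range (\<lambda>i. \<tau> i x)) n)
        = (\<Sum>n\<in>(\<lambda>i. \<tau> i x) ` {1..I}. v n)"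
    proof -
      have "(\<lambda>i. \<tau> i x) ` {1..I} = {1..N} \<inter> range (\<lambda>i. \<tau> i x)"
      proof (intro equalityI subsetI)
        fix n assume "n \<in> (\<lambda>i. \<tau> i x) ` {1..I}"
        then show "n \<in> {1..N} \<inter> range (\<lambda>i. \<tau> i x)"
          using le_iff \<tau>_ge[OF x] by (auto intro: order_trans)
      next
        fix n assume "n \<in> {1..N} \<inter> range (\<lambda>i. \<tau> i x)"
        then obtain i where i: "n = \<tau> i x" "1 \<le> n" "n \<le> N" by auto
        then have "i \<noteq> 0" using \<tau>_0[OF x] by (intro notI) simp
        then show "n \<in> (\<lambda>i. \<tau> i x) ` {1..I}" using i le_iff by auto
      qed
      then show ?thesis by (simp add: sum.inter_restrict indicator_def if_distrib cong: if_cong)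
    qed
    also have "\<dots> = (\<Sum>j\<in>{1..I}. v (\<tau> j x))"
      using bij by (subst sum.reindex) (auto intro: inj_on_subset)
    finally have lhs: "exp (\<Sum>n=1..N. v n * indicator (range (\<lambda>i. \<tau> i x)) n)
        = exp (\<Sum>j\<in>{1..I}. v (\<tau> j x))" by simp
    \<comment> \<open>Exactly one pair \<open>(i, k)\<close> contributes: \<open>i\<close> is the index of the last renewal up to \<open>N\<close>.\<close>
    have last: "path_term v i k x * of_bool (\<xi> i x > N - k)
        = (if i = I then if k = \<tau> I x then exp (\<Sum>j\<in>{1..I}. v (\<tau> j x)) else 0 else 0)"
      if "k \<le> N" for i k
    proof (cases "\<tau> i x = k \<and> \<xi> i x > N - k")
      case True
      then have "i \<le> I" "\<not> Suc i \<le> I" using that le_iff[of i] le_iff[of "Suc i"] by (auto simp: \<xi>_def)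
      then have "i = I" by simp
      then show ?thesis using True by (auto simp: path_term_def)
    next
      case False
      then have "\<not> (i = I \<and> k = \<tau> I x)" using I_Suc that by (auto simp: \<xi>_def)
      then show ?thesis using False by (auto simp: path_term_def)
    qed
    have "(\<Sum>k\<le>N. \<Sum>i\<le>N. path_term v i k x * of_bool (\<xi> i x > N - k))
        = (\<Sum>k\<le>N. if k = \<tau> I x then exp (\<Sum>j\<in>{1..I}. v (\<tau> j x)) else 0)"
      using last order_trans[OF \<tau>_ge[OF x] I]
      by (intro sum.cong refl) (simp add: last)
    also have "\<dots> = exp (\<Sum>j\<in>{1..I}. v (\<tau> j x))" using I by simp
    finally show "exp (\<Sum>n=1..N. v n * indicator (range (\<lambda>i. \<tau> i x)) n)
        = (\<Sum>k\<le>N. \<Sum>i\<le>N. path_term v i k x * of_bool (\<xi> i x > N - k))"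
      using lhs by simp
  qed
  also have "\<dots> = (\<Sum>k\<le>N. \<Sum>i\<le>N. expectation (\<lambda>x. path_term v i k x * of_bool (\<xi> i x > N - k)))"
  proof -
    have "integrable M (\<lambda>x. path_term v i k x * of_bool (\<xi> i x > N - k))" for i k
      by (rule Bochner_Integration.integrable_bound[OF path_term_integrable[of v i k]])
         (auto intro!: AE_I2)
    then show ?thesis
      by (simp only: Bochner_Integration.integral_sum Bochner_Integration.integrable_sum)
  qed
  also have "\<dots> = (\<Sum>k\<le>N. \<Sum>i\<le>N. path_weight v i k * survival (N - k))"
  proof (intro sum.cong refl)
    fix k i
    have "expectation (\<lambda>x. of_bool (\<xi> i x > N - k) :: real) = survival (N - k)"
    proof -
      have "expectation (\<lambda>x. of_bool (\<xi> i x > N - k) :: real)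
          = expectation (indicator (space M - {x \<in> space M. \<xi> i x \<le> N - k}))"
        by (intro Bochner_Integration.integral_cong) auto
      then show ?thesis by (simp add: prob_compl prob_\<xi>_le survival_def)
    qed
    then show "expectation (\<lambda>x. path_term v i k x * of_bool (\<xi> i x > N - k))
        = path_weight v i k * survival (N - k)"
      using path_term_indep[of "\<lambda>n. of_bool (n > N - k)" v i k] by (simp add: path_weight_def)
  qed
  also have "\<dots> = (\<Sum>k\<le>N. Z v k * survival (N - k))"
    by (intro sum.cong refl) (simp add: Z_eq_path_weights[of _ N] sum_distrib_right)
  finally show ?thesis unfolding v_def .
qed

end

section \<open>Power-law inter-arrival tails\<close>

text \<open>
  This bounds the cost of a long jump.
\<close>
lemma regular_tail_lower_bound:
  assumes "K \<sim>[at_top] (\<lambda>n. c\<^sub>K * real n powr (-(1 + \<alpha>)))" "c\<^sub>K > 0"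
  obtains n0 :: nat and c :: real where "n0 \<ge> 1" "c > 0"
    "\<And>n. n \<ge> n0 \<Longrightarrow> c * real n powr (-(1 + \<alpha>)) \<le> K n"
proof -
  define g where "g n = c\<^sub>K * real n powr (-(1 + \<alpha>))" for n :: nat
  have g_pos: "g n > 0" if "n > 0" for n using that assms(2) by (simp add: g_def)
  have "eventually (\<lambda>n. K n \<noteq> 0 \<or> g n \<noteq> 0) sequentially"
    using eventually_gt_at_top[of 0] by eventually_elim (metis g_pos less_irrefl)
  then have "(\<lambda>n. K n / g n) \<longlonglongrightarrow> 1"
    using assms(1) unfolding g_def[symmetric] by (intro asymp_equivD_strong)
  then have "eventually (\<lambda>n. 1 / 2 < K n / g n) sequentially" by (rule order_tendstoD) simp
  then obtain m where m: "\<And>n. n \<ge> m \<Longrightarrow> 1 / 2 < K n / g n" by (auto simp: eventually_sequentially)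
  show thesis
  proof (rule that[of "max m 1" "c\<^sub>K / 2"])
    fix n assume n: "n \<ge> max m 1"
    then have "1 / 2 * g n < K n" using m[of n] g_pos[of n] by (simp add: pos_less_divide_eq)
    then show "c\<^sub>K / 2 * real n powr (-(1 + \<alpha>)) \<le> K n" by (simp add: g_def)
  qed (use assms(2) in auto)
qed

locale pinning = renewal M \<tau> K for M :: "'a measure" and \<tau> K +
  fixes n0 :: nat and c \<alpha> :: real
  assumes n0_ge_1: "n0 \<ge> 1" and c_pos: "c > 0" and \<alpha>_pos: "\<alpha> > 0"
    and K_lower: "\<And>n. n \<ge> n0 \<Longrightarrow> c * real n powr (-(1 + \<alpha>)) \<le> K n"
begin

lemma K_pos: "n \<ge> n0 \<Longrightarrow> K n > 0"
proof -
  assume n: "n \<ge> n0"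
  then have "0 < c * real n powr (-(1 + \<alpha>))" using c_pos n0_ge_1 by simp
  then show ?thesis using K_lower[OF n] by (rule less_le_trans)
qed

lemma Z_ge_K: "n \<ge> 1 \<Longrightarrow> K n * exp (v n) \<le> Z v n"
  using Z_jump[of n v 0] by simp

lemma Z_pos: "n \<ge> n0 \<Longrightarrow> Z v n > 0"
proof -
  assume n: "n \<ge> n0"
  have "0 < K n * exp (v n)" using K_pos[OF n] by simp
  then show ?thesis using Z_ge_K[of n v] n n0_ge_1 by linarith
qed

text \<open>
  The tangent line of the concave function \<open>ln\<close> at \<open>A\<close> bounds the logarithmic cost of a jump of
  length \<open>g\<close> by a fixed cost per jump plus a cost proportional to \<open>g\<close>.  With \<open>A\<close> the typical jump
  length this loses nothing essential, and affine costs add up along a trajectory whatever the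
  individual jumps are.
\<close>
lemma ln_K_lower:
  assumes "g \<ge> n0" "A > 0"
  shows "exp (- ((1 + \<alpha>) * ln A - ln c) - (1 + \<alpha>) / A * real g) \<le> K g"
proof -
  have g: "real g > 0" using assms n0_ge_1 by simp
  have "ln (real g / A) \<le> real g / A" using ln_le_minus_one[of "real g / A"] g assms by simp
  then have "ln (real g) \<le> ln A + real g / A" using g assms by (simp add: ln_div)
  then have "(1 + \<alpha>) * ln (real g) \<le> (1 + \<alpha>) * (ln A + real g / A)"
    using \<alpha>_pos by (intro mult_left_mono) auto
  then have "- ((1 + \<alpha>) * ln A - ln c) - (1 + \<alpha>) / A * real g \<le> ln c + (- (1 + \<alpha>) * ln (real g))"
    by (simp add: algebra_simps)
  then have "exp (- ((1 + \<alpha>) * ln A - ln c) - (1 + \<alpha>) / A * real g)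
      \<le> exp (ln c + (- (1 + \<alpha>) * ln (real g)))" by simp
  also have "\<dots> = c * real g powr (- (1 + \<alpha>))" using g c_pos by (simp add: exp_add powr_def)
  finally show ?thesis using K_lower[OF assms(1)] by linarith
qed

lemma ln_Z_bound:
  assumes N: "N \<ge> n0" and v: "\<And>n. \<bar>v n\<bar> \<le> V"
  shows "\<bar>ln (Z v N)\<bar> \<le> (\<bar>ln c\<bar> + 1 + \<alpha> + V) * real N"
proof -
  have V: "V \<ge> 0" using v[of 0] by linarith
  have N1: "real N \<ge> 1" using N n0_ge_1 by simp
  have "ln (Z v N) \<le> V * real N"
  proof -
    have "Z v N \<le> exp (V * real N)" using v by (intro Z_upper V) (auto simp: abs_le_iff)
    then have "ln (Z v N) \<le> ln (exp (V * real N))" using Z_pos[OF N, of v] by (subst ln_le_cancel_iff) auto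
    then show ?thesis by simp
  qed
  moreover have "V * real N \<le> (\<bar>ln c\<bar> + 1 + \<alpha> + V) * real N"
    using \<alpha>_pos by (intro mult_right_mono) auto
  moreover have "- ((\<bar>ln c\<bar> + 1 + \<alpha> + V) * real N) \<le> ln (Z v N)"
  proof -
    have "exp (ln c - (1 + \<alpha>) * real N - V) \<le> K N * exp (v N)"
    proof -
      have "exp (- ((1 + \<alpha>) * ln 1 - ln c) - (1 + \<alpha>) / 1 * real N) \<le> K N"
        by (intro ln_K_lower N) simp
      moreover have "exp (- V) \<le> exp (v N)" using v[of N] by simp
      ultimately have "exp (ln c - (1 + \<alpha>) * real N) * exp (- V) \<le> K N * exp (v N)"
        by (intro mult_mono K_nonneg) auto
      then show ?thesis by (simp add: mult_exp_exp)
    qed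
    also have "\<dots> \<le> Z v N" using N n0_ge_1 by (intro Z_ge_K) simp
    finally have "ln c - (1 + \<alpha>) * real N - V \<le> ln (Z v N)"
      using Z_pos[OF N] by (simp add: ln_ge_iff)
    moreover have "\<bar>ln c\<bar> * 1 \<le> \<bar>ln c\<bar> * real N" "V * 1 \<le> V * real N"
      using N1 V by (intro mult_left_mono; simp)+
    ultimately show ?thesis using V by (simp add: algebra_simps)
  qed
  ultimately show ?thesis by linarith
qed

lemma Z_le_partition_function:
  "Z (\<lambda>n. h + \<beta> * w n) N \<le> partition_function M \<tau> \<beta> h w N"
proof -
  have "Z (\<lambda>n. h + \<beta> * w n) N * survival (N - N)
      \<le> (\<Sum>k\<le>N. Z (\<lambda>n. h + \<beta> * w n) k * survival (N - k))"
    by (rule member_le_sum[of N "{..N}" "\<lambda>k. Z (\<lambda>n. h + \<beta> * w n) k * survival (N - k)"])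
       (auto intro!: mult_nonneg_nonneg Z_nonneg survival_bounds)
  then show ?thesis by (simp add: partition_function_eq survival_def K_0)
qed

text \<open>
  After the last renewal \<open>k \<le> N\<close>, add a jump to \<open>N + n0\<close>.  The shift by \<open>n0\<close> makes the jump long
  enough for the lower bound on its probability.
\<close>
lemma partition_function_le_Z:
  fixes w :: "nat \<Rightarrow> real"
  assumes v: "\<And>n. \<bar>h + \<beta> * w n\<bar> \<le> V"
  shows "partition_function M \<tau> \<beta> h w N
    \<le> (real (N + 1) * real (N + n0) powr (1 + \<alpha>) * exp V / c) * Z (\<lambda>n. h + \<beta> * w n) (N + n0)"
proof -
  define v where "v n = h + \<beta> * w n" for n
  define R where "R = real (N + n0) powr (1 + \<alpha>) * exp V / c"
  have R: "R > 0" using c_pos n0_ge_1 by (auto simp: R_def)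
  have "Z v k * survival (N - k) \<le> R * Z v (N + n0)" if k: "k \<le> N" for k
  proof -
    define g where "g = N + n0 - k"
    have g: "g \<ge> n0" "k + g = N + n0" using k by (auto simp: g_def)
    have "1 / R = c * real (N + n0) powr (- (1 + \<alpha>)) * exp (- V)"
      by (simp only: R_def powr_minus exp_minus divide_inverse inverse_mult_distrib
          inverse_inverse_eq mult_1_left mult_ac)
    also have "\<dots> \<le> c * real g powr (- (1 + \<alpha>)) * exp (v (N + n0))"
      using c_pos g n0_ge_1 \<alpha>_pos v[of "N + n0"]
      by (intro mult_mono mult_left_mono powr_mono2') (auto simp: v_def abs_le_iff)
    also have "\<dots> \<le> K g * exp (v (N + n0))" using K_lower[OF g(1)] by simp
    finally have "Z v k * (1 / R) \<le> Z v k * (K g * exp (v (k + g)))"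
      using Z_nonneg g by (intro mult_left_mono) auto
    also have "\<dots> \<le> Z v (N + n0)" using Z_jump[of g v k] g n0_ge_1 by simp
    finally have "Z v k \<le> R * Z v (N + n0)" using R by (simp add: pos_divide_le_eq mult.commute)
    moreover have "Z v k * survival (N - k) \<le> Z v k * 1"
      by (intro mult_left_mono Z_nonneg survival_bounds)
    ultimately show ?thesis by simp
  qed
  then have "(\<Sum>k\<le>N. Z v k * survival (N - k)) \<le> (\<Sum>k\<le>N. R * Z v (N + n0))" by (intro sum_mono) auto
  then show ?thesis by (simp add: partition_function_eq v_def[symmetric] R_def)
qed

lemma ln_partition_function_tendsto:
  fixes w :: "nat \<Rightarrow> real"
  assumes v: "\<And>n. \<bar>h + \<beta> * w n\<bar> \<le> V"
    and lim: "(\<lambda>N. ln (Z (\<lambda>n. h + \<beta> * w n) N) / real N) \<longlonglongrightarrow> f"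
  shows "(\<lambda>N. ln (partition_function M \<tau> \<beta> h w N) / real N) \<longlonglongrightarrow> f"
proof (rule tendsto_sandwich[OF _ _ lim])
  define v where "v n = h + \<beta> * w n" for n
  define F where "F = partition_function M \<tau> \<beta> h w"
  define D where "D = V - ln c"
  define r where "r N = real (N + n0) / real N" for N
  have F_ge: "Z v N \<le> F N" for N unfolding v_def F_def by (rule Z_le_partition_function)
  show "eventually (\<lambda>N. ln (Z (\<lambda>n. h + \<beta> * w n) N) / real N
      \<le> ln (partition_function M \<tau> \<beta> h w N) / real N) sequentially"
    unfolding v_def[symmetric] F_def[symmetric] using eventually_ge_at_top[of n0]
  proof eventually_elim
    case (elim N)
    then show ?case using Z_pos[OF elim, of v] F_ge[of N] by (intro divide_right_mono) auto
  qed
  define U where "U N = r N * ((2 + \<alpha>) * (ln (real (N + n0)) / real (N + n0))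
      + ln (Z v (N + n0)) / real (N + n0)) + D / real N" for N
  show "eventually (\<lambda>N. ln (partition_function M \<tau> \<beta> h w N) / real N \<le> U N) sequentially"
    unfolding F_def[symmetric] using eventually_ge_at_top[of n0]
  proof eventually_elim
    case (elim N)
    have N: "real N > 0" "real (N + n0) > 0" using elim n0_ge_1 by auto
    have Zp: "Z v (N + n0) > 0" by (intro Z_pos) simp
    have "F N \<le> (real (N + 1) * real (N + n0) powr (1 + \<alpha>) * exp V / c) * Z v (N + n0)"
      unfolding F_def v_def by (rule partition_function_le_Z[OF v])
    also have "\<dots> \<le> (real (N + n0) * real (N + n0) powr (1 + \<alpha>) * exp V / c) * Z v (N + n0)"
      using n0_ge_1 c_pos Zp by (intro mult_right_mono divide_right_mono) auto
    finally have "ln (F N) \<le> ln ((real (N + n0) * real (N + n0) powr (1 + \<alpha>) * exp V / c) * Z v (N + n0))"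
      using F_ge[of N] Z_pos[OF elim, of v] by (subst ln_le_cancel_iff) auto
    also have "\<dots> = (2 + \<alpha>) * ln (real (N + n0)) + ln (Z v (N + n0)) + D"
      using N Zp c_pos by (simp add: ln_mult ln_div ln_powr D_def algebra_simps del: of_nat_add)
    finally have "ln (F N) / real N \<le> ((2 + \<alpha>) * ln (real (N + n0)) + ln (Z v (N + n0)) + D) / real N"
      using N by (intro divide_right_mono) auto
    also have "\<dots> = U N"
    proof -
      have "r N * (x / real (N + n0)) = x / real N" for x using N by (simp add: r_def)
      then have "r N * ((2 + \<alpha>) * (ln (real (N + n0)) / real (N + n0)) + ln (Z v (N + n0)) / real (N + n0))
          = ((2 + \<alpha>) * ln (real (N + n0)) + ln (Z v (N + n0))) / real N"
        by (metis add_divide_distrib times_divide_eq_right)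
      then show ?thesis by (simp only: U_def add_divide_distrib)
    qed
    finally show ?case .
  qed
  have r: "r \<longlonglongrightarrow> 1"
  proof -
    have "(\<lambda>N. 1 + real n0 / real N) \<longlonglongrightarrow> 1 + 0" by (intro tendsto_intros lim_const_over_n)
    moreover have "eventually (\<lambda>N. 1 + real n0 / real N = r N) sequentially"
      using eventually_gt_at_top[of 0] by eventually_elim (simp add: r_def field_simps)
    ultimately show ?thesis using tendsto_cong by force
  qed
  have "(\<lambda>N. ln (real (N + n0)) / real (N + n0)) \<longlonglongrightarrow> 0"
    by (rule LIMSEQ_ignore_initial_segment[OF lim_ln_over_n])
  moreover have "(\<lambda>N. ln (Z v (N + n0)) / real (N + n0)) \<longlonglongrightarrow> f"
    using LIMSEQ_ignore_initial_segment[OF lim, of n0] by (simp only: v_def[abs_def])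
  ultimately have "U \<longlonglongrightarrow> 1 * ((2 + \<alpha>) * 0 + f) + 0"
    unfolding U_def[abs_def] by (intro tendsto_intros r lim_const_over_n)
  then show "U \<longlonglongrightarrow> f" by simp
qed

text \<open>
  With all jumps restricted to length at most \<open>L\<close>, the partial sums \<open>A\<close> of the pinned partition
  functions grow by the factor \<open>exp e * (\<Sum>j\<le>L. K j)\<close> whenever the range is extended by \<open>L\<close>.  By
  recurrence this factor exceeds \<open>1\<close> for large \<open>L\<close>, so \<open>A\<close> grows exponentially, which is impossible
  if no pinned partition function exceeds \<open>1\<close>.
\<close>
lemma homogeneous_gain:
  assumes "e > 0"
  shows "\<exists>m\<ge>1. Z (\<lambda>_. e) m > 1"
proof (rule ccontr)
  assume "\<not> ?thesis"
  then have small: "Z (\<lambda>_. e) m \<le> 1" for m by (cases "m = 0") (auto simp: not_less)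
  define a where "a = Z (\<lambda>_. e)"
  have a0: "a m \<ge> 0" for m by (simp add: a_def Z_nonneg)
  have "(\<lambda>L. exp e * (\<Sum>j\<le>L. K j)) \<longlonglongrightarrow> exp e * 1"
    by (intro tendsto_intros K_sum_tendsto)
  then have "eventually (\<lambda>L. 1 < exp e * (\<Sum>j\<le>L. K j)) sequentially"
    by (rule order_tendstoD) (use assms in simp)
  then obtain L where L: "1 < exp e * (\<Sum>j\<le>L. K j)" by (auto simp: eventually_sequentially)
  define r where "r = exp e * (\<Sum>j\<le>L. K j)"
  define A where "A N = (\<Sum>m\<le>N. a m)" for N
  have step: "r * A N \<le> A (N + L)" for N
  proof -
    have "(\<Sum>j\<le>L. K j) = (\<Sum>g\<in>{1..L}. K g)"
      using K_0 by (subst sum.mono_neutral_right[of "{..L}" "{1..L}"]) (auto simp: not_le less_Suc0)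
    then have "r * A N = exp e * (\<Sum>l\<le>N. \<Sum>g\<in>{1..L}. a l * K g)"
      by (simp add: r_def A_def sum_product mult.commute mult.left_commute)
    also have "(\<Sum>l\<le>N. \<Sum>g\<in>{1..L}. a l * K g) = (\<Sum>(l, g)\<in>{..N} \<times> {1..L}. a l * K g)"
      by (rule sum.cartesian_product)
    also have "\<dots> = (\<Sum>(m, l)\<in>(\<lambda>(l, g). (l + g, l)) ` ({..N} \<times> {1..L}). a l * K (m - l))"
      by (subst sum.reindex) (auto simp: inj_on_def intro!: sum.cong)
    also have "\<dots> \<le> (\<Sum>(m, l)\<in>(SIGMA m:{1..N + L}. {..<m}). a l * K (m - l))"
      by (intro sum_mono2) (auto intro!: mult_nonneg_nonneg a0 K_nonneg)
    also have "\<dots> = (\<Sum>m\<in>{1..N + L}. \<Sum>l<m. a l * K (m - l))" by (rule sum.Sigma[symmetric]) auto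
    finally have "r * A N \<le> exp e * (\<Sum>m\<in>{1..N + L}. \<Sum>l<m. a l * K (m - l))" by simp
    also have "\<dots> = (\<Sum>m\<in>{1..N + L}. a m)"
      unfolding sum_distrib_left
      by (intro sum.cong refl) (simp add: a_def pinned_rec sum_distrib_left mult.commute)
    also have "\<dots> \<le> A (N + L)" unfolding A_def by (intro sum_mono2) (auto simp: a0)
    finally show ?thesis .
  qed
  have r: "r > 1" using L by (simp add: r_def)
  have "r ^ j \<le> A (j * L)" for j
  proof (induction j)
    case 0 then show ?case by (simp add: A_def a_def)
  next
    case (Suc j)
    then have "r * r ^ j \<le> r * A (j * L)" using r by simp
    then show ?case using step[of "j * L"] by (simp add: add.commute)
  qed
  moreover have "A N \<le> real N + 1" for N
    using sum_mono[of "{..N}" a "\<lambda>_. 1"] small by (simp add: A_def a_def)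
  ultimately have bd: "r ^ j \<le> real j * real L + 1" for j by (metis of_nat_mult order_trans)
  have "(\<lambda>j. real j * inverse r ^ j * real L + inverse r ^ j) \<longlonglongrightarrow> 0 * real L + 0"
    using r by (intro tendsto_intros powser_times_n_limit_0 LIMSEQ_power_zero) (auto simp: inverse_less_1_iff)
  moreover have "1 \<le> real j * inverse r ^ j * real L + inverse r ^ j" for j
    using bd[of j] r mult_right_mono[OF bd[of j], of "inverse r ^ j"]
    by (simp add: power_inverse algebra_simps)
  ultimately have "1 \<le> (0 * real L + 0 :: real)" by (intro LIMSEQ_le_const) auto
  then show False by simp
qed

text \<open>
  A renewal that visits only blocks contained in the set \<open>G\<close> of favourable sites.  Induction over the
  positions where a block ends: from the last block end \<open>M'\<close> that does not overlap the current
  block, jump to the \<open>n0\<close>-th site of the block, which makes every jump at least \<open>n0\<close> long, and collect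
  the gain \<open>g\<close> on its last \<open>L\<close> sites.  Block ends between \<open>M'\<close> and \<open>N\<close> all lie among the \<open>n\<close> sites
  of the current block, so each counted block end is worth at least \<open>(g - b) / n\<close>.
\<close>
lemma rare_block_strategy:
  fixes v :: "nat \<Rightarrow> real" and L n :: nat and G :: "nat set"
  defines "n \<equiv> n0 + L"
  defines "block_end \<equiv> \<lambda>N. n \<le> N \<and> {N - n<..N} \<subseteq> G"
  assumes good: "\<And>i. i \<in> G \<Longrightarrow> v i = e" and e: "e \<ge> 0"
    and gain: "exp g \<le> Z (\<lambda>_. e) L" and \<eta>: "\<eta> \<ge> 0" and b: "b \<le> g"
    and jump: "\<And>j. j \<ge> n0 \<Longrightarrow> exp (- b - \<eta> * real j) \<le> K j"
    and N: "block_end N"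
  shows "exp ((g - b) / real n * real (card {j\<in>{1..N}. block_end j}) - \<eta> * real N) \<le> Z v N"
  using N
proof (induction N rule: less_induct)
  case (less N)
  define cnt where "cnt N = card {j\<in>{1..N}. block_end j}" for N
  define \<gamma> where "\<gamma> = (g - b) / real n"
  have n1: "n \<ge> 1" using n0_ge_1 by (simp add: n_def)
  have \<gamma>: "\<gamma> \<ge> 0" "\<gamma> * real n = g - b" using b n1 by (auto simp: \<gamma>_def)
  have nN: "n \<le> N" and block: "{N - n<..N} \<subseteq> G" using less.prems by (auto simp: block_end_def)
  define S where "S = {j. j \<le> N - n \<and> block_end j}"
  define M' where "M' = (if S = {} then 0 else Max S)"
  have finS: "finite S" by (rule finite_subset[of _ "{..N}"]) (auto simp: S_def)
  have M'_in: "M' \<in> S" if "S \<noteq> {}" using that finS by (simp add: M'_def)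
  have M'_le: "M' \<le> N - n" using M'_in by (cases "S = {}") (auto simp: M'_def S_def)
  have prev: "exp (\<gamma> * real (cnt M') - \<eta> * real M') \<le> Z v M'"
  proof (cases "S = {}")
    case True then show ?thesis by (simp add: M'_def cnt_def)
  next
    case False
    then show ?thesis using less.IH[of M'] M'_in M'_le n1 nN
      by (auto simp: cnt_def \<gamma>_def S_def)
  qed
  have cnt_le: "cnt N \<le> cnt M' + n"
  proof -
    have "j \<le> M'" if "block_end j" "j \<le> N - n" for j
      using that finS by (auto simp: M'_def S_def)
    then have "{j\<in>{1..N}. block_end j} \<subseteq> {j\<in>{1..M'}. block_end j} \<union> {N - n<..N}" by force
    then have "cnt N \<le> card ({j\<in>{1..M'}. block_end j} \<union> {N - n<..N})"
      unfolding cnt_def by (intro card_mono) auto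
    also have "\<dots> \<le> cnt M' + card {N - n<..N}" unfolding cnt_def by (rule card_Un_le)
    finally show ?thesis using nN by simp
  qed
  define j where "j = N - L - M'"
  have j: "j \<ge> n0" "M' + j = N - L" "N - L + L = N" using M'_le nN by (auto simp: j_def n_def)
  have land: "v (N - L) = e" using nN n0_ge_1 by (intro good subsetD[OF block]) (auto simp: n_def)
  have "exp (\<gamma> * real (cnt N) - \<eta> * real N)
      \<le> exp (\<gamma> * real (cnt M') - \<eta> * real M' + (- b - \<eta> * real j) + g)"
  proof -
    have "\<gamma> * real (cnt N) \<le> \<gamma> * real (cnt M' + n)" using cnt_le \<gamma> by (intro mult_left_mono) linarith+
    then have "\<gamma> * real (cnt N) \<le> \<gamma> * real (cnt M') + (g - b)" using \<gamma>(2) by (simp add: distrib_left)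
    moreover have "\<eta> * real (M' + j) \<le> \<eta> * real N" using j \<eta> by (intro mult_left_mono) auto
    ultimately show ?thesis by (simp add: distrib_left)
  qed
  also have "\<dots> = exp (\<gamma> * real (cnt M') - \<eta> * real M') * (exp (- b - \<eta> * real j) * 1) * exp g"
    by (simp add: mult_exp_exp)
  also have "\<dots> \<le> Z v M' * (K j * exp (v (M' + j))) * Z (\<lambda>_. e) L"
    using prev jump[OF j(1)] gain land e j(2) Z_nonneg K_nonneg
    by (intro mult_mono) auto
  also have "\<dots> \<le> Z v (N - L) * Z (\<lambda>i. v (i + (N - L))) L"
  proof (intro mult_mono Z_nonneg)
    show "Z v M' * (K j * exp (v (M' + j))) \<le> Z v (N - L)"
      using Z_jump[of j v M'] j n0_ge_1 by simp
    have "v (i + (N - L)) = e" if "i \<in> {1..L}" for i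
      using that nN n0_ge_1 by (intro good subsetD[OF block]) (auto simp: n_def)
    then show "Z (\<lambda>_. e) L \<le> Z (\<lambda>i. v (i + (N - L))) L" by (intro Z_mono) simp
  qed
  also have "\<dots> \<le> Z v N" using Z_supermult[of v "N - L" L] j by simp
  finally show ?case by (simp add: cnt_def \<gamma>_def)
qed

end

section \<open>The environment and the free energy\<close>

text \<open>
  The rewards are read off from the event \<open>s n = 1\<close> alone, so they are bounded on every sequence,
  also on those that are not sequences of spins.
\<close>
definition weights :: "real \<Rightarrow> real \<Rightarrow> (nat \<Rightarrow> real) \<Rightarrow> nat \<Rightarrow> real" where
  "weights \<beta> h s n = (if s n = 1 then h + \<beta> else h - \<beta>)"

locale environment = prob_space P for P :: "'b measure" +
  fixes \<omega> :: "nat \<Rightarrow> 'b \<Rightarrow> real"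
  assumes environment: "stationary_ergodic P \<omega>"
    and spins: "\<And>i y. y \<in> space P \<Longrightarrow> \<omega> i y \<in> {-1, 1}"
begin

abbreviation "\<Omega> \<equiv> (\<Pi>\<^sub>M i\<in>(UNIV::nat set). (borel :: real measure))"
definition "Q = distr P \<Omega> (\<lambda>y i. \<omega> i y)"
definition shift :: "(nat \<Rightarrow> real) \<Rightarrow> nat \<Rightarrow> real" where "shift s = (\<lambda>i. s (Suc i))"

lemma \<omega>_measurable [measurable]: "\<omega> i \<in> borel_measurable P"
  using environment by (simp add: stationary_ergodic_def)

lemma \<omega>_seq_measurable [measurable]: "(\<lambda>y i. \<omega> i y) \<in> measurable P \<Omega>"
  by (rule measurable_abs_UNIV) simp

lemma sets_Q [simp]: "sets Q = sets \<Omega>" and space_Q [simp]: "space Q = UNIV"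
  by (simp_all add: Q_def space_PiM)

lemma shift_measurable: "shift \<in> measurable \<Omega> \<Omega>"
  unfolding shift_def[abs_def]
  by (rule measurable_abs_UNIV) (rule measurable_component_singleton, simp)

lemma measure_Q: "A \<in> sets \<Omega> \<Longrightarrow> measure Q A = prob {y \<in> space P. (\<lambda>i. \<omega> i y) \<in> A}"
  unfolding Q_def by (subst measure_distr) (auto simp: vimage_def Int_def conj_commute)

sublocale seq: ergodic_system Q shift
proof -
  interpret Q: prob_space Q unfolding Q_def by (rule prob_space_distr) simp
  show "ergodic_system Q shift"
  proof
    show "shift \<in> measurable Q Q"
      using shift_measurable by (simp add: measurable_def sets_Q space_PiM)
    have "distr Q Q shift = distr Q \<Omega> shift" by (rule distr_cong) simp_all
    also have "\<dots> = distr P \<Omega> (\<lambda>y i. \<omega> (Suc i) y)"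
      unfolding Q_def by (subst distr_distr[OF shift_measurable]) (simp_all add: comp_def shift_def)
    also have "\<dots> = Q" using environment by (simp add: stationary_ergodic_def Q_def)
    finally show "distr Q Q shift = Q" .
    fix A assume "A \<in> sets Q" and inv: "shift -` A \<inter> space Q = A"
    then have A: "A \<in> sets \<Omega>" by simp
    have "{s. (\<lambda>i. s (Suc i)) \<in> A} = A" using inv by (auto simp: shift_def)
    then show "measure Q A \<in> {0, 1}"
      using environment A by (simp add: stationary_ergodic_def measure_Q)
  qed
qed

lemma shift_iterate: "(shift ^^ n) s = (\<lambda>i. s (i + n))"
  by (induction n arbitrary: s) (simp_all add: funpow_swap1 shift_def)

lemma AE_Q_D: "AE s in Q. \<Phi> s \<Longrightarrow> AE y in P. \<Phi> (\<lambda>i. \<omega> i y)"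
  unfolding Q_def by (rule AE_distrD[OF \<omega>_seq_measurable])

definition plus_prob :: "nat set \<Rightarrow> real" where "plus_prob E = prob (all_plus P \<omega> E)"

lemma all_plus_measurable [measurable]: "all_plus P \<omega> E \<in> sets P"
  unfolding all_plus_def by measurable

lemma all_plus_seq_measurable: "{s. \<forall>i\<in>E. s i = 1} \<in> sets \<Omega>"
proof -
  have "(\<Inter>i\<in>E. {s \<in> space \<Omega>. s i = 1}) \<in> sets \<Omega>" if "E \<noteq> {}"
    using that by (intro sets.countable_INT') auto
  moreover have "(\<Inter>i\<in>E. {s \<in> space \<Omega>. s i = 1}) = {s. \<forall>i\<in>E. s i = 1}" by (auto simp: space_PiM)
  ultimately show ?thesis
    by (cases "E = {}") (use sets.top[of \<Omega>] in \<open>auto simp: space_PiM\<close>)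
qed

lemma plus_prob_eq: "plus_prob E = measure Q {s. \<forall>i\<in>E. s i = 1}"
  by (simp add: measure_Q all_plus_seq_measurable plus_prob_def all_plus_def)

lemma plus_prob_shift: "plus_prob ((\<lambda>i. i + k) ` E) = plus_prob E"
proof -
  have "plus_prob E = measure Q ((shift ^^ k) -` {s. \<forall>i\<in>E. s i = 1} \<inter> space Q)"
    unfolding plus_prob_eq by (subst seq.prob_iterate_vimage) (simp_all add: all_plus_seq_measurable)
  also have "(shift ^^ k) -` {s. \<forall>i\<in>E. s i = 1} \<inter> space Q = {s. \<forall>i\<in>(\<lambda>i. i + k) ` E. s i = 1}"
    by (auto simp: shift_iterate)
  finally show ?thesis by (simp add: plus_prob_eq)
qed

lemma plus_prob_antimono: "E \<subseteq> E' \<Longrightarrow> plus_prob E' \<le> plus_prob E"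
  unfolding plus_prob_def by (intro finite_measure_mono) (auto simp: all_plus_def)

lemma plus_prob_bounds: "0 \<le> plus_prob E" "plus_prob E \<le> 1"
  by (simp_all add: plus_prob_def)

text \<open>
  Non-increasing correlations say this for a nonempty prefix, and stationarity for the empty one.
\<close>
lemma plus_prob_pull_left:
  assumes corr: "nonincreasing_correlations P \<omega>"
    and E: "finite E" "E \<noteq> {}" "\<And>i. i \<in> E \<Longrightarrow> k < i"
  shows "plus_prob ({1..k} \<union> (\<lambda>i. i + j) ` E) \<le> plus_prob ({1..k} \<union> E)"
proof (cases "k = 0")
  case True
  then show ?thesis by (simp add: plus_prob_shift)
next
  case False
  then have k: "{1..k} \<noteq> {}" "Max {1..k} = k" by (auto intro!: Max_eqI)
  have E1: "E \<subseteq> {1..}" using E(3) by force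
  have less: "Max {1..k} < Min E" using E k by simp
  show ?thesis
  proof (induction j)
    case (Suc j)
    have "plus_prob ({1..k} \<union> (\<lambda>i. i + (j + 1)) ` E) \<le> plus_prob ({1..k} \<union> (\<lambda>i. i + j) ` E)"
      using corr[unfolded nonincreasing_correlations_def, rule_format,
          OF finite_atLeastAtMost E(1) k(1) E(2) _ E1 less, of j] by (simp add: plus_prob_def)
    with Suc show ?case by simp
  qed simp
qed

text \<open>
  Pull the set \<open>E\<close> to the left until its first point is adjacent to the prefix \<open>{1..k}\<close>, which only
  increases the probability; absorb that point into the prefix and repeat.
\<close>
lemma plus_prob_prefix:
  assumes corr: "nonincreasing_correlations P \<omega>"
    and "finite E" "\<And>i. i \<in> E \<Longrightarrow> k < i"
  shows "plus_prob ({1..k} \<union> E) \<le> plus_prob {1..k + card E}"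
  using assms(2,3)
proof (induction "card E" arbitrary: k E)
  case (Suc c)
  then have ne: "E \<noteq> {}" by auto
  define g where "g = Min E - (k + 1)"
  define E' where "E' = (\<lambda>i. i - g) ` E"
  have Min: "Min E \<in> E" "k < Min E" using Suc.prems ne by auto
  have ge: "g + k < i" if "i \<in> E" for i
    using Min_le[OF Suc.prems(1) that] Min by (simp add: g_def)
  have E: "E = (\<lambda>i. i + g) ` E'" using ge by (force simp: E'_def image_image intro!: image_eqI)
  have card: "card E' = card E"
    unfolding E'_def by (intro card_image inj_onI) (metis ge add_lessD1 less_imp_le le_add_diff_inverse)
  have E': "finite E'" "E' \<noteq> {}" "\<And>i. i \<in> E' \<Longrightarrow> k < i"
    using Suc.prems ne ge by (force simp: E'_def)+
  have mem: "k + 1 \<in> E'" using Min by (force simp: E'_def g_def intro!: image_eqI[of _ _ "Min E"])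
  have "plus_prob ({1..k} \<union> E) \<le> plus_prob ({1..k} \<union> E')"
    using plus_prob_pull_left[OF corr E', of g] E by simp
  also have "{1..k} \<union> E' = {1..k + 1} \<union> (E' - {k + 1})" using mem by (auto simp: le_Suc_eq)
  also have "plus_prob \<dots> \<le> plus_prob {1..(k + 1) + card (E' - {k + 1})}"
    using Suc.hyps(2) card E' mem
    by (intro Suc.hyps(1)) (auto simp: card_Diff_singleton le_less Suc_lessI dest: E'(3))
  also have "(k + 1) + card (E' - {k + 1}) = k + card E"
    using Suc.hyps(2) card mem E' by (simp add: card_Diff_singleton)
  finally show ?case .
qed simp

end

lemma (in renewal_law) Z_measurable:
  assumes "\<And>n. (\<lambda>s. v s n) \<in> borel_measurable S"
  shows "(\<lambda>s. Z (v s) N) \<in> borel_measurable S"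
proof (induction N rule: less_induct)
  case (less N)
  show ?case
  proof (cases "N = 0")
    case False
    have "(\<lambda>s. (\<Sum>l<N. Z (v s) l * K (N - l)) * exp (v s N)) \<in> borel_measurable S"
      using less assms[of N] measurable_compose[OF assms[of N] borel_measurable_exp]
      by (intro borel_measurable_times borel_measurable_sum) auto
    then show ?thesis using False by (simp add: pinned_rec)
  qed simp
qed

text \<open>
  Averaging over the environment does not commute with the recursion, but the statement with an
  additional finite product of weights beyond \<open>N\<close> is stable under it: each step moves the site \<open>N\<close> from
  the partition function into the product.
\<close>
lemma (in renewal_law) annealed_bound:
  fixes v :: "'s \<Rightarrow> nat \<Rightarrow> real"
  assumes "prob_space S"
    and meas: "\<And>n. (\<lambda>s. v s n) \<in> borel_measurable S"
    and V: "\<And>s n. \<bar>v s n\<bar> \<le> V"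
    and moment: "\<And>D. finite D \<Longrightarrow> D \<subseteq> {1..} \<Longrightarrow> (\<integral>s. (\<Prod>n\<in>D. exp (v s n)) \<partial>S) \<le> C"
  shows "(\<integral>s. Z (v s) N \<partial>S) \<le> C"
proof -
  interpret prob_space S by fact
  have V0: "V \<ge> 0" using V[of undefined 0] by linarith
  have [measurable]: "(\<lambda>s. Z (v s) l * (\<Prod>n\<in>D. exp (v s n))) \<in> borel_measurable S" for l D
    using Z_measurable[OF meas] measurable_compose[OF meas borel_measurable_exp]
    by (intro borel_measurable_times borel_measurable_prod)
  have int: "integrable S (\<lambda>s. Z (v s) l * (\<Prod>n\<in>D. exp (v s n)))" for l D
  proof (rule integrable_const_bound[of _ "exp (V * real l) * exp V ^ card D"])
    have "Z (v s) l * (\<Prod>n\<in>D. exp (v s n)) \<le> exp (V * real l) * exp V ^ card D" for s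
      using V by (intro mult_mono Z_upper V0 prod_le_power prod_nonneg) (auto simp: abs_le_iff V0)
    then show "AE s in S. norm (Z (v s) l * (\<Prod>n\<in>D. exp (v s n))) \<le> exp (V * real l) * exp V ^ card D"
      by (auto simp: Z_nonneg prod_nonneg abs_mult abs_prod)
  qed measurable
  have C: "C \<ge> 0" using moment[of "{}"] by (simp add: prob_space)
  have "(\<integral>s. Z (v s) N * (\<Prod>n\<in>D. exp (v s n)) \<partial>S) \<le> C"
    if "finite D" "D \<subseteq> {N<..}" for D
    using that
  proof (induction N arbitrary: D rule: less_induct)
    case (less N)
    show ?case
    proof (cases "N = 0")
      case True
      have "D \<subseteq> {1..}" using less.prems True by (auto simp: Suc_le_eq)
      then show ?thesis using moment[of D] less.prems True by simp
    next
      case False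
      have notin: "N \<notin> D" using less.prems by auto
      have "(\<integral>s. Z (v s) N * (\<Prod>n\<in>D. exp (v s n)) \<partial>S)
          = (\<integral>s. (\<Sum>l<N. K (N - l) * (Z (v s) l * (\<Prod>n\<in>insert N D. exp (v s n)))) \<partial>S)"
        using False less.prems notin
        by (intro Bochner_Integration.integral_cong refl)
           (simp add: pinned_rec sum_distrib_left sum_distrib_right mult_ac)
      also have "\<dots> = (\<Sum>l<N. K (N - l) * (\<integral>s. Z (v s) l * (\<Prod>n\<in>insert N D. exp (v s n)) \<partial>S))"
        by (simp only: Bochner_Integration.integral_sum integrable_mult_right int integral_mult_right_zero)
      also have "\<dots> \<le> (\<Sum>l<N. K (N - l) * C)"
        using less.prems False
        by (intro sum_mono mult_left_mono K_nonneg less.IH) auto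
      also have "\<dots> = (\<Sum>l<N. K (N - l)) * C" by (simp add: sum_distrib_right)
      also have "\<dots> \<le> 1 * C" by (intro mult_right_mono K_sum_reflected_le C)
      finally show ?thesis by simp
    qed
  qed
  from this[of "{}"] show ?thesis by simp
qed


locale pinning_model =
  pinning M \<tau> K n0 c \<alpha> + env: environment P \<omega>
  for M :: "'a measure" and \<tau> K n0 c \<alpha> and P :: "'b measure" and \<omega>
begin

abbreviation W :: "real \<Rightarrow> real \<Rightarrow> 'b \<Rightarrow> nat \<Rightarrow> real" where
  "W \<beta> h y \<equiv> weights \<beta> h (\<lambda>i. \<omega> i y)"

abbreviation F :: "real \<Rightarrow> real \<Rightarrow> real" where
  "F \<beta> h \<equiv> free_energy M \<tau> P \<omega> \<beta> h"

lemma weights_bound: "\<bar>weights \<beta> h s n\<bar> \<le> \<bar>h\<bar> + \<bar>\<beta>\<bar>"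
  by (auto simp: weights_def)

lemma weights_spins: "y \<in> space P \<Longrightarrow> W \<beta> h y = (\<lambda>n. h + \<beta> * \<omega> n y)"
  using env.spins[of y] by (auto simp: weights_def fun_eq_iff) (metis insert_iff mult_minus1_right singletonD)

lemma weights_measurable: "(\<lambda>s. weights \<beta> h s n) \<in> borel_measurable env.Q"
proof -
  have [measurable]: "(\<lambda>s. s n) \<in> borel_measurable env.Q"
    unfolding measurable_cong_sets[OF env.sets_Q refl] by (rule measurable_component_singleton) simp
  show ?thesis unfolding weights_def by measurable
qed

lemma free_energy_limit_Q:
  "\<exists>f. AE s in env.Q. (\<lambda>N. ln (Z (weights \<beta> h s) N) / real N) \<longlonglongrightarrow> f"
proof -
  define V where "V = \<bar>h\<bar> + \<bar>\<beta>\<bar>"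
  interpret S: superadditive_process env.Q env.shift "\<lambda>N s. ln (Z (weights \<beta> h s) N)" n0
    "\<bar>ln c\<bar> + 1 + \<alpha> + V"
  proof
    fix n assume "n0 \<le> n"
    show "(\<lambda>s. ln (Z (weights \<beta> h s) n)) \<in> borel_measurable env.Q"
      by (intro borel_measurable_ln Z_measurable weights_measurable)
  next
    fix n and s :: "nat \<Rightarrow> real" assume "n0 \<le> n"
    then show "\<bar>ln (Z (weights \<beta> h s) n)\<bar> \<le> (\<bar>ln c\<bar> + 1 + \<alpha> + V) * real n"
      unfolding V_def by (rule ln_Z_bound[OF _ weights_bound])
  next
    fix m n and s :: "nat \<Rightarrow> real" assume mn: "n0 \<le> m" "n0 \<le> n"
    have "weights \<beta> h ((env.shift ^^ m) s) = (\<lambda>i. weights \<beta> h s (i + m))"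
      by (simp add: env.shift_iterate weights_def fun_eq_iff)
    then have "Z (weights \<beta> h s) m * Z (weights \<beta> h ((env.shift ^^ m) s)) n \<le> Z (weights \<beta> h s) (m + n)"
      using Z_supermult[of "weights \<beta> h s" m n] by simp
    then have "ln (Z (weights \<beta> h s) m * Z (weights \<beta> h ((env.shift ^^ m) s)) n)
        \<le> ln (Z (weights \<beta> h s) (m + n))"
      using Z_pos[OF mn(1), of "weights \<beta> h s"] Z_pos[OF mn(2), of "weights \<beta> h ((env.shift ^^ m) s)"]
      by (subst ln_le_cancel_iff) (auto simp: mn intro!: Z_pos trans_le_add1)
    then show "ln (Z (weights \<beta> h s) m) + ln (Z (weights \<beta> h ((env.shift ^^ m) s)) n)
        \<le> ln (Z (weights \<beta> h s) (m + n))"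
      using Z_pos[OF mn(1), of "weights \<beta> h s"] Z_pos[OF mn(2), of "weights \<beta> h ((env.shift ^^ m) s)"]
      by (simp add: ln_mult)
  qed (rule n0_ge_1)
  show ?thesis by (rule S.superadditive_ergodic_theorem)
qed

theorem free_energy_limit:
  "AE y in P. (\<lambda>N. ln (Z (W \<beta> h y) N) / real N) \<longlonglongrightarrow> F \<beta> h"
proof -
  obtain f where "AE s in env.Q. (\<lambda>N. ln (Z (weights \<beta> h s) N) / real N) \<longlonglongrightarrow> f"
    using free_energy_limit_Q by blast
  then have Zf: "AE y in P. (\<lambda>N. ln (Z (W \<beta> h y) N) / real N) \<longlonglongrightarrow> f" by (rule env.AE_Q_D)
  have pf: "AE y in P. (\<lambda>N. ln (partition_function M \<tau> \<beta> h (\<lambda>i. \<omega> i y) N) / real N) \<longlonglongrightarrow> f"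
    using Zf AE_space
  proof eventually_elim
    case (elim y)
    then show ?case
      using weights_bound[of \<beta> h "\<lambda>i. \<omega> i y"]
      by (intro ln_partition_function_tendsto[of h \<beta> _ "\<bar>h\<bar> + \<bar>\<beta>\<bar>"]) (simp_all add: weights_spins fun_eq_iff)
  qed
  have "F \<beta> h = f"
    unfolding free_energy_def
  proof (rule the_equality, rule pf)
    fix f' assume "AE y in P. (\<lambda>N. ln (partition_function M \<tau> \<beta> h (\<lambda>i. \<omega> i y) N) / real N) \<longlonglongrightarrow> f'"
    with pf have "AE y in P. f' = f" by eventually_elim (rule LIMSEQ_unique)
    then show "f' = f" by simp
  qed
  then show ?thesis using Zf by simp
qed

lemma F_nonpos:
  assumes "\<beta> \<ge> 0" "h \<le> - \<beta>"
  shows "F \<beta> h \<le> 0"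
proof -
  have "AE y in P. F \<beta> h \<le> 0"
    using free_energy_limit[of \<beta> h]
  proof eventually_elim
    case (elim y)
    have "ln (Z (W \<beta> h y) N) / real N \<le> 0" for N
      using Z_upper[of 0 N "W \<beta> h y"] Z_nonneg[of "W \<beta> h y" N] assms
      by (cases "Z (W \<beta> h y) N = 0") (auto simp: weights_def divide_nonpos_nonneg)
    then show ?case using elim by (intro LIMSEQ_le_const2) auto
  qed
  then show ?thesis by simp
qed

lemma F_mono:
  assumes "h \<le> h'" shows "F \<beta> h \<le> F \<beta> h'"
proof -
  have "AE y in P. F \<beta> h \<le> F \<beta> h'"
    using free_energy_limit[of \<beta> h] free_energy_limit[of \<beta> h']
  proof eventually_elim
    case (elim y)
    have "eventually (\<lambda>N. ln (Z (W \<beta> h y) N) / real N \<le> ln (Z (W \<beta> h' y) N) / real N) sequentially"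
      using eventually_ge_at_top[of n0]
    proof eventually_elim
      case (elim N)
      have "Z (W \<beta> h y) N \<le> Z (W \<beta> h' y) N" using assms by (intro Z_mono) (auto simp: weights_def)
      then show ?case using Z_pos[OF elim, of "W \<beta> h y"] by (intro divide_right_mono) auto
    qed
    then show ?case using elim by (intro tendsto_le[OF sequentially_bot]) auto
  qed
  then show ?thesis by simp
qed

lemma F_lipschitz:
  assumes "t \<ge> 0" shows "F \<beta> h - t \<le> F \<beta> (h - t)"
proof -
  have "AE y in P. F \<beta> h - t \<le> F \<beta> (h - t)"
    using free_energy_limit[of \<beta> h] free_energy_limit[of \<beta> "h - t"]
  proof eventually_elim
    case (elim y)
    have "eventually (\<lambda>N. ln (Z (W \<beta> h y) N) / real N - t \<le> ln (Z (W \<beta> (h - t) y) N) / real N) sequentially"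
      using eventually_ge_at_top[of n0]
    proof eventually_elim
      case (elim N)
      have w: "W \<beta> (h - t) y = (\<lambda>n. W \<beta> h y n - t)" by (auto simp: weights_def fun_eq_iff)
      have N: "real N > 0" using elim n0_ge_1 by simp
      have "ln (exp (- (t * real N)) * Z (W \<beta> h y) N) \<le> ln (Z (W \<beta> (h - t) y) N)"
        using Z_lower_tilt[OF assms, of N "W \<beta> h y"] Z_pos[OF elim, of "W \<beta> h y"]
          Z_pos[OF elim, of "W \<beta> (h - t) y"]
        unfolding w by (subst ln_le_cancel_iff) auto
      then have "ln (Z (W \<beta> h y) N) - t * real N \<le> ln (Z (W \<beta> (h - t) y) N)"
        using Z_pos[OF elim, of "W \<beta> h y"] by (simp add: ln_mult)
      then have "(ln (Z (W \<beta> h y) N) - t * real N) / real N \<le> ln (Z (W \<beta> (h - t) y) N) / real N"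
        using N by (intro divide_right_mono) auto
      then show ?case using N by (simp add: diff_divide_distrib)
    qed
    then show ?case using elim
      by (intro tendsto_le[OF sequentially_bot _ tendsto_diff[OF _ tendsto_const]]) auto
  qed
  then show ?thesis by simp
qed

text \<open>
  For large \<open>h\<close>, a single jump of length \<open>n0\<close> already has a weight above \<open>1\<close>, and it can be iterated.
\<close>
lemma F_pos_large: "\<exists>h. F \<beta> h > 0"
proof -
  define a where "a = \<bar>ln (K n0)\<bar> + 1"
  define h where "h = a + \<bar>\<beta>\<bar>"
  define q where "q = Z (\<lambda>_. a) n0"
  have Kp: "K n0 > 0" by (intro K_pos) simp
  have "1 < exp (ln (K n0) + a)" unfolding a_def by (subst one_less_exp_iff) linarith
  also have "\<dots> = K n0 * exp a" using Kp by (simp add: exp_add)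
  also have "\<dots> \<le> q" unfolding q_def using n0_ge_1 by (rule Z_ge_K)
  finally have q: "q > 1" .
  have "AE y in P. ln q / real n0 \<le> F \<beta> h"
    using free_energy_limit[of \<beta> h]
  proof eventually_elim
    case (elim y)
    have "ln q / real n0 \<le> ln (Z (W \<beta> h y) (Suc k * n0)) / real (Suc k * n0)" for k
    proof -
      have "q ^ Suc k \<le> Z (\<lambda>_. a) (Suc k * n0)" unfolding q_def by (rule Z_power)
      also have "\<dots> \<le> Z (W \<beta> h y) (Suc k * n0)"
        by (intro Z_mono) (auto simp: weights_def h_def)
      finally have "ln (q ^ Suc k) \<le> ln (Z (W \<beta> h y) (Suc k * n0))"
        using q by (subst ln_le_cancel_iff) (auto intro: less_le_trans[of 0 "q ^ Suc k"])
      then have le: "real (Suc k) * ln q / real (Suc k * n0) \<le> ln (Z (W \<beta> h y) (Suc k * n0)) / real (Suc k * n0)"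
        using q by (intro divide_right_mono) (simp_all add: ln_realpow del: power_Suc)
      have "real (Suc k) * ln q / real (Suc k * n0) = ln q / real n0"
        unfolding of_nat_mult by (rule mult_divide_mult_cancel_left) simp
      with le show ?thesis by (simp only:)
    qed
    moreover have "strict_mono (\<lambda>k. Suc k * n0)" using n0_ge_1 by (intro strict_monoI) simp
    ultimately show ?case
      using LIMSEQ_subseq_LIMSEQ[OF elim, of "\<lambda>k. Suc k * n0"]
      by (intro LIMSEQ_le_const) (auto simp: comp_def)
  qed
  then have "ln q / real n0 \<le> F \<beta> h" by simp
  moreover have "ln q / real n0 > 0" using q n0_ge_1 by simp
  ultimately show ?thesis by (intro exI[of _ h]) linarith
qed

text \<open>
  By the Lipschitz bound the set of \<open>h\<close> with positive free energy does not contain its infimum.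
\<close>
lemma critical_point_iff:
  assumes "\<beta> \<ge> 0"
  shows "F \<beta> h > 0 \<longleftrightarrow> h > critical_point M \<tau> P \<omega> \<beta>"
proof -
  define hc where "hc = Inf {h. F \<beta> h > 0}"
  have bdd: "bdd_below {h. F \<beta> h > 0}"
    using F_nonpos[OF assms] by (intro bdd_belowI[of _ "- \<beta>"]) (metis mem_Collect_eq linorder_not_le nle_le)
  have hc: "\<forall>h. F \<beta> h > 0 \<longleftrightarrow> h > hc"
  proof (intro allI iffI)
    fix h assume h: "F \<beta> h > 0"
    have "F \<beta> (h - F \<beta> h / 2) > 0" using F_lipschitz[of "F \<beta> h / 2" \<beta> h] h by linarith
    then have "hc \<le> h - F \<beta> h / 2" unfolding hc_def using bdd by (intro cInf_lower) auto
    then show "h > hc" using h by linarith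
  next
    fix h assume "h > hc"
    then obtain h' where "F \<beta> h' > 0" "h' < h"
      unfolding hc_def using cInf_lessD[of "{h. F \<beta> h > 0}" h] F_pos_large by auto
    then show "F \<beta> h > 0" using F_mono[of h' h \<beta>] by linarith
  qed
  have "critical_point M \<tau> P \<omega> \<beta> = hc"
    unfolding critical_point_def
  proof (rule the_equality, rule hc)
    fix x assume "\<forall>h. F \<beta> h > 0 \<longleftrightarrow> h > x"
    then have "\<And>h. h > x \<longleftrightarrow> h > hc" using hc by blast
    then show "x = hc" by (metis less_irrefl linorder_neqE_linordered_idom)
  qed
  then show ?thesis using hc by simp
qed

end

section \<open>Finite and infinite disorder\<close>

context environment
begin

lemma infinite_disorderD:
  assumes "infinite_disorder P \<omega>" "\<delta> > 0"
  shows "\<exists>n\<ge>m. exp (- (\<delta> * real n)) \<le> plus_prob {1..n}"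
proof (rule ccontr)
  assume "\<not> ?thesis"
  then have small: "plus_prob {1..n} < exp (- (\<delta> * real n))" if "n \<ge> m" for n
    using that by (meson not_le)
  have "eventually (\<lambda>n. ereal \<delta> \<le> minus_log (plus_prob {1..n}) / ereal (real n)) sequentially"
  proof (rule eventually_sequentiallyI[of "max m 1"])
    fix n assume n: "n \<ge> max m 1"
    show "ereal \<delta> \<le> minus_log (plus_prob {1..n}) / ereal (real n)"
    proof (cases "plus_prob {1..n} = 0")
      case True
      then show ?thesis using n by (simp add: minus_log_def divide_ereal_def)
    next
      case False
      then have "plus_prob {1..n} > 0" using plus_prob_bounds(1)[of "{1..n}"] by linarith
      then have "ln (plus_prob {1..n}) < ln (exp (- (\<delta> * real n)))"
        using small[of n] n by (subst ln_less_cancel_iff) auto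
      then have "\<delta> * real n \<le> - ln (plus_prob {1..n})" by simp
      then have "\<delta> \<le> - ln (plus_prob {1..n}) / real n" using n by (subst pos_le_divide_eq) auto
      then show ?thesis using n False by (simp add: minus_log_def)
    qed
  qed
  then have "ereal \<delta> \<le> liminf (\<lambda>n. minus_log (plus_prob {1..n}) / ereal (real n))"
    by (rule Liminf_bounded)
  then show False using assms by (simp add: infinite_disorder_def plus_prob_def)
qed

lemma not_infinite_disorderD:
  assumes "\<not> infinite_disorder P \<omega>"
  shows "\<exists>\<rho> C. 0 < \<rho> \<and> \<rho> < 1 \<and> (\<forall>n. plus_prob {1..n} \<le> C * \<rho> ^ n)"
proof -
  define u where "u n = minus_log (plus_prob {1..n}) / ereal (real n)" for n
  have "eventually (\<lambda>n. 0 \<le> u n) sequentially"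
  proof (rule eventually_sequentiallyI[of 1])
    fix n :: nat assume "n \<ge> 1"
    then show "0 \<le> u n"
    proof (cases "plus_prob {1..n} = 0")
      case False
      then have "ln (plus_prob {1..n}) \<le> 0"
        using plus_prob_bounds[of "{1..n}"] by (subst ln_le_zero_iff) auto
      then have "0 \<le> - ln (plus_prob {1..n}) / real n" by (intro divide_nonneg_nonneg) auto
      then show ?thesis using \<open>n \<ge> 1\<close> False by (simp add: u_def minus_log_def)
    qed (use \<open>n \<ge> 1\<close> in \<open>simp add: u_def minus_log_def divide_ereal_def\<close>)
  qed
  then have "0 \<le> liminf u" by (rule Liminf_bounded)
  moreover have "liminf u \<noteq> 0"
    using assms by (simp add: infinite_disorder_def plus_prob_def u_def[abs_def])
  ultimately have "0 < liminf u" by simp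
  then obtain c where c: "0 < c" "ereal c < liminf u"
    using ereal_dense2[of 0 "liminf u"] by auto
  from less_LiminfD[OF c(2)] obtain m where m: "\<And>n. n \<ge> m \<Longrightarrow> ereal c < u n"
    by (auto simp: eventually_sequentially)
  have "plus_prob {1..n} \<le> exp (c * real (Suc m)) * exp (- c) ^ n" for n
  proof (cases "n \<ge> Suc m \<and> plus_prob {1..n} \<noteq> 0")
    case True
    then have n: "n \<ge> m" "real n > 0" and p: "plus_prob {1..n} > 0"
      using plus_prob_bounds(1)[of "{1..n}"] by auto
    have "c < - ln (plus_prob {1..n}) / real n"
      using m[OF n(1)] True by (simp add: u_def minus_log_def)
    then have "c * real n < - ln (plus_prob {1..n})" by (simp only: pos_less_divide_eq[OF n(2)])
    then have "ln (plus_prob {1..n}) \<le> - (c * real n)" by simp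
    then have "plus_prob {1..n} \<le> exp (- (c * real n))" using p by (metis exp_le_cancel_iff exp_ln)
    also have "\<dots> = exp (- c) ^ n" by (simp add: exp_of_nat_mult[symmetric] mult.commute)
    also have "\<dots> \<le> exp (c * real (Suc m)) * exp (- c) ^ n"
      using c by (simp add: mult_le_cancel_right1)
    finally show ?thesis .
  next
    case False
    show ?thesis
    proof (cases "plus_prob {1..n} = 0")
      case nz: False
      with False have "n \<le> Suc m" by simp
      then have "c * real n \<le> c * real (Suc m)" using c by (intro mult_left_mono) auto
      then have "1 \<le> exp (c * real (Suc m) + - (c * real n))" by simp
      also have "\<dots> = exp (c * real (Suc m)) * exp (- c) ^ n"
        by (simp only: exp_add exp_of_nat_mult[symmetric]) (simp add: mult.commute)
      finally show ?thesis using plus_prob_bounds(2)[of "{1..n}"] by linarith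
    qed simp
  qed
  then show ?thesis
    by (intro exI[of _ "exp (- c)"] exI[of _ "exp (c * real (Suc m))"]) (use c in auto)
qed

end

context pinning_model
begin

lemma W_measurable: "(\<lambda>y. W \<beta> h y n) \<in> borel_measurable P"
  unfolding weights_def by measurable

text \<open>
  If the free energy were positive, the partition functions would tend to infinity almost surely, and
  by Fatou's lemma so would their means.
\<close>
lemma annealed_free_energy_nonpos:
  assumes mean: "\<And>N. (\<integral>y. Z (W \<beta> h y) N \<partial>P) \<le> C"
  shows "F \<beta> h \<le> 0"
proof (rule ccontr)
  assume "\<not> F \<beta> h \<le> 0"
  then have pos: "F \<beta> h > 0" by simp
  have meas [measurable]: "(\<lambda>y. Z (W \<beta> h y) N) \<in> borel_measurable P" for N
    by (rule Z_measurable[OF W_measurable])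
  have "integrable P (\<lambda>y. Z (W \<beta> h y) N)" for N
  proof (rule env.integrable_const_bound[of _ "exp ((\<bar>h\<bar> + \<bar>\<beta>\<bar>) * real N)"])
    have "Z (W \<beta> h y) N \<le> exp ((\<bar>h\<bar> + \<bar>\<beta>\<bar>) * real N)" for y
      using weights_bound[of \<beta> h "\<lambda>i. \<omega> i y"] by (intro Z_upper) (auto simp: abs_le_iff)
    then show "AE y in P. norm (Z (W \<beta> h y) N) \<le> exp ((\<bar>h\<bar> + \<bar>\<beta>\<bar>) * real N)"
      by (simp add: Z_nonneg)
  qed simp
  then have nn: "(\<integral>\<^sup>+y. ennreal (Z (W \<beta> h y) N) \<partial>P) \<le> ennreal C" for N
    using mean by (subst nn_integral_eq_integral) (auto simp: Z_nonneg intro!: ennreal_leI)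
  have "AE y in P. liminf (\<lambda>N. ennreal (Z (W \<beta> h y) N)) = top"
    using free_energy_limit[of \<beta> h]
  proof eventually_elim
    case (elim y)
    have "eventually (\<lambda>N. F \<beta> h / 2 < ln (Z (W \<beta> h y) N) / real N) sequentially"
      using elim pos by (intro order_tendstoD(1)) auto
    then have "eventually (\<lambda>N. F \<beta> h / 2 * real N \<le> Z (W \<beta> h y) N) sequentially"
      using eventually_ge_at_top[of n0]
    proof eventually_elim
      case (elim N)
      then have "F \<beta> h / 2 * real N \<le> ln (Z (W \<beta> h y) N)"
        using n0_ge_1 by (simp add: pos_less_divide_eq)
      also have "\<dots> \<le> Z (W \<beta> h y) N"
        using ln_le_minus_one[OF Z_pos[OF elim(2), of "W \<beta> h y"]] by simp
      finally show ?case .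
    qed
    moreover have "filterlim (\<lambda>N. F \<beta> h / 2 * real N) at_top sequentially"
      using pos by (intro filterlim_tendsto_pos_mult_at_top[OF tendsto_const] filterlim_real_sequentially) simp
    ultimately have "filterlim (\<lambda>N. Z (W \<beta> h y) N) at_top sequentially"
      by (rule filterlim_at_top_mono[rotated])
    then have "(\<lambda>N. ennreal (Z (W \<beta> h y) N)) \<longlonglongrightarrow> top"
      by (simp add: ennreal_tendsto_top_eq_at_top)
    then show ?case by (intro lim_imp_Liminf) simp_all
  qed
  then have "(\<integral>\<^sup>+y. liminf (\<lambda>N. ennreal (Z (W \<beta> h y) N)) \<partial>P) = (\<integral>\<^sup>+y. top \<partial>P)"
    by (rule nn_integral_cong_AE)
  also have "\<dots> = top" by (simp add: env.emeasure_space_1)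
  finally have "top \<le> liminf (\<lambda>N. \<integral>\<^sup>+y. ennreal (Z (W \<beta> h y) N) \<partial>P)"
    using nn_integral_liminf[of "\<lambda>N y. ennreal (Z (W \<beta> h y) N)" P] by simp
  also have "\<dots> \<le> ennreal C" using nn by (intro Liminf_le) auto
  finally show False by (simp add: top_unique)
qed

text \<open>
  With \<open>q = exp (- 2 * \<beta>)\<close>, the choice of \<open>h\<close> makes the weights at a \<open>+1\<close> and a \<open>-1\<close> equal to
  \<open>exp e\<close> and \<open>exp e * q\<close>.  Expanding the product over a set \<open>D\<close> of renewals according to the subset of
  sites with \<open>+1\<close>, and dropping the information that the others are \<open>-1\<close>, bounds its mean by
  \<open>C * (exp e * (\<rho> + q)) ^ card D\<close>; the constants are chosen so that the base is \<open>1\<close>.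
\<close>
lemma exponential_decay_shifts_critical_point:
  assumes \<rho>: "0 < \<rho>" "\<rho> < 1"
    and decay: "\<And>E. finite E \<Longrightarrow> E \<subseteq> {1..} \<Longrightarrow> env.plus_prob E \<le> C * \<rho> ^ card E"
  shows "\<exists>\<beta>>0. \<exists>h>-\<beta>. F \<beta> h \<le> 0"
proof -
  define q where "q = (1 - \<rho>) / 2"
  define \<beta> where "\<beta> = - ln q / 2"
  define e where "e = - ln (\<rho> + q)"
  define h where "h = - \<beta> + e"
  have q: "0 < q" "q < 1" "0 < \<rho> + q" "\<rho> + q < 1" using \<rho> by (auto simp: q_def field_simps)
  have \<beta>: "\<beta> > 0" and e: "e > 0" using q by (auto simp: \<beta>_def e_def)
  have E: "exp e * (\<rho> + q) = 1" using q by (simp add: e_def exp_minus)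
  have "h + \<beta> = e" "h - \<beta> = e + ln q" by (simp_all add: h_def \<beta>_def)
  then have plus: "exp (h + \<beta>) = exp e" and minus: "exp (h - \<beta>) = exp e * q"
    using q by (simp_all only: exp_add exp_ln)
  have "(\<integral>y. (\<Prod>n\<in>D. exp (W \<beta> h y n)) \<partial>P) \<le> C" if D: "finite D" "D \<subseteq> {1..}" for D
  proof -
    define f where "f X y = exp e ^ card X * (exp e * q) ^ card (D - X) * indicator (all_plus P \<omega> X) y"
      for X y
    have int: "integrable P (f X)" for X
      unfolding f_def[abs_def] by (intro integrable_mult_right) (simp add: env.emeasure_eq_measure)
    have "(\<integral>y. (\<Prod>n\<in>D. exp (W \<beta> h y n)) \<partial>P) \<le> (\<integral>y. (\<Sum>X\<in>Pow D. f X y) \<partial>P)"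
    proof (rule integral_mono_AE')
      show "integrable P (\<lambda>y. \<Sum>X\<in>Pow D. f X y)" using int by simp
      show "AE y in P. 0 \<le> (\<Sum>X\<in>Pow D. f X y)" using q by (simp add: f_def sum_nonneg)
      show "AE y in P. (\<Prod>n\<in>D. exp (W \<beta> h y n)) \<le> (\<Sum>X\<in>Pow D. f X y)"
      proof (rule AE_I2)
        fix y assume y: "y \<in> space P"
        have "(\<Prod>n\<in>D. exp (W \<beta> h y n)) \<le> (\<Prod>n\<in>D. exp e * of_bool (\<omega> n y = 1) + exp e * q)"
          using q by (intro prod_mono) (auto simp: weights_def plus minus)
        also have "\<dots> = (\<Sum>X\<in>Pow D. (\<Prod>n\<in>X. exp e * of_bool (\<omega> n y = 1)) * (\<Prod>n\<in>D - X. exp e * q))"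
          by (rule prod_add) (rule D)
        also have "\<dots> = (\<Sum>X\<in>Pow D. f X y)"
        proof (intro sum.cong refl)
          fix X assume "X \<in> Pow D"
          then have X: "finite X" using D finite_subset by auto
          have "(\<Prod>n\<in>X. of_bool (\<omega> n y = 1)) = (indicator (all_plus P \<omega> X) y :: real)"
          proof (cases "y \<in> all_plus P \<omega> X")
            case True then show ?thesis by (simp add: all_plus_def)
          next
            case False
            then have "\<exists>n\<in>X. of_bool (\<omega> n y = 1) = (0::real)" using y by (auto simp: all_plus_def)
            then show ?thesis using False X prod_zero by (simp add: indicator_def)
          qed
          then show "(\<Prod>n\<in>X. exp e * of_bool (\<omega> n y = 1)) * (\<Prod>n\<in>D - X. exp e * q) = f X y"
            by (simp add: f_def prod.distrib mult_ac)
        qed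
        finally show "(\<Prod>n\<in>D. exp (W \<beta> h y n)) \<le> (\<Sum>X\<in>Pow D. f X y)" .
      qed
    qed
    also have "\<dots> = (\<Sum>X\<in>Pow D. exp e ^ card X * (exp e * q) ^ card (D - X) * env.plus_prob X)"
      using int by (subst Bochner_Integration.integral_sum) (auto simp: f_def[abs_def] env.plus_prob_def)
    also have "\<dots> \<le> (\<Sum>X\<in>Pow D. C * ((exp e * \<rho>) ^ card X * (exp e * q) ^ card (D - X)))"
    proof (intro sum_mono)
      fix X assume X: "X \<in> Pow D"
      have "env.plus_prob X \<le> C * \<rho> ^ card X" using X D by (intro decay) (auto intro: finite_subset)
      then have "exp e ^ card X * (exp e * q) ^ card (D - X) * env.plus_prob X
          \<le> exp e ^ card X * (exp e * q) ^ card (D - X) * (C * \<rho> ^ card X)"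
        using q by (intro mult_left_mono) auto
      then show "exp e ^ card X * (exp e * q) ^ card (D - X) * env.plus_prob X
          \<le> C * ((exp e * \<rho>) ^ card X * (exp e * q) ^ card (D - X))"
        by (simp add: power_mult_distrib mult_ac)
    qed
    also have "\<dots> = C * (\<Prod>n\<in>D. exp e * \<rho> + exp e * q)"
      by (subst prod_add[OF D(1)]) (simp add: sum_distrib_left)
    also have "\<dots> = C" using E by (simp add: distrib_left)
    finally show ?thesis .
  qed
  then have "(\<integral>y. Z (W \<beta> h y) N \<partial>P) \<le> C" for N
    by (intro annealed_bound[OF env.prob_space_axioms W_measurable weights_bound])
  then have "F \<beta> h \<le> 0" by (rule annealed_free_energy_nonpos)
  moreover have "h > - \<beta>" using e by (simp add: h_def)
  ultimately show ?thesis using \<beta> by blast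
qed

text \<open>
  The block ends counted in \<open>rare_block_strategy\<close> have the frequency of the pattern of \<open>n\<close>
  consecutive \<open>+1\<close>, by Birkhoff's theorem.
\<close>
lemma rare_block_free_energy:
  fixes L n :: nat
  assumes "\<beta> > 0" "e > 0"
    and n: "n = n0 + L"
    and gain: "exp g \<le> Z (\<lambda>_. e) L" and \<eta>: "\<eta> \<ge> 0" and b: "b \<le> g"
    and jump: "\<And>j. j \<ge> n0 \<Longrightarrow> exp (- b - \<eta> * real j) \<le> K j"
    and p: "env.plus_prob {1..n} > 0"
  shows "(g - b) / real n * env.plus_prob {1..n} - \<eta> \<le> F \<beta> (- \<beta> + e)"
proof -
  define p where "p = env.plus_prob {1..n}"
  define \<gamma> where "\<gamma> = (g - b) / real n"
  define B where "B = {s :: nat \<Rightarrow> real. \<forall>i\<in>{1..n}. s i = 1}"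
  have n1: "n \<ge> 1" using n n0_ge_1 by simp
  have \<gamma>: "\<gamma> \<ge> 0" using b by (simp add: \<gamma>_def)
  have B: "B \<in> sets env.Q" unfolding B_def env.sets_Q by (rule env.all_plus_seq_measurable)
  have "AE s in env.Q. (\<lambda>N. (\<Sum>i<N. indicator B ((env.shift ^^ i) s)) / real N)
      \<longlonglongrightarrow> (\<integral>s. indicator B s \<partial>env.Q)"
    by (rule env.seq.birkhoff_bounded[OF borel_measurable_indicator[OF B], of 1]) auto
  moreover have "(\<integral>s. indicator B s \<partial>env.Q) = p"
    using B by (simp add: p_def env.plus_prob_eq B_def)
  ultimately have "AE s in env.Q. (\<lambda>N. (\<Sum>i<N. indicator B ((env.shift ^^ i) s)) / real N) \<longlonglongrightarrow> p"
    by simp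
  then have "AE y in P. (\<lambda>N. (\<Sum>i<N. indicator B ((env.shift ^^ i) (\<lambda>i. \<omega> i y))) / real N) \<longlonglongrightarrow> p"
    by (rule env.AE_Q_D)
  then have "AE y in P. \<gamma> * p - \<eta> \<le> F \<beta> (- \<beta> + e)"
    using free_energy_limit[of \<beta> "- \<beta> + e"]
  proof eventually_elim
    case (elim y)
    define v where "v = W \<beta> (- \<beta> + e) y"
    define G where "G = {i. \<omega> i y = 1}"
    define block_end where "block_end N \<longleftrightarrow> n \<le> N \<and> {N - n<..N} \<subseteq> G" for N
    define cnt where "cnt N = card {j\<in>{1..N}. block_end j}" for N
    define S where "S N = (\<Sum>i<N. indicator B ((env.shift ^^ i) (\<lambda>i. \<omega> i y)) :: real)" for N
    have S_lim: "(\<lambda>N. S N / real N) \<longlonglongrightarrow> p" using elim(1) by (simp add: S_def)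
    have F_lim: "(\<lambda>N. ln (Z v N) / real N) \<longlonglongrightarrow> F \<beta> (- \<beta> + e)" using elim(2) by (simp add: v_def)
    have iff: "(env.shift ^^ i) (\<lambda>i. \<omega> i y) \<in> B \<longleftrightarrow> block_end (i + n)" for i
    proof -
      have shifted: "{i<..i + n} = (\<lambda>j. j + i) ` {1..n}"
        by (auto intro!: image_eqI[of _ _ "_ - i"])
      have "block_end (i + n) \<longleftrightarrow> (\<forall>j\<in>{1..n}. \<omega> (j + i) y = 1)"
        by (simp only: block_end_def add_diff_cancel_right' shifted le_add2 simp_thms
            image_subset_iff G_def mem_Collect_eq)
      then show ?thesis by (simp add: B_def env.shift_iterate)
    qed
    have S_eq: "S N = real (card {i. i < N \<and> block_end (i + n)})" for N
    proof -
      have "S N = (\<Sum>i<N. of_bool (block_end (i + n)))"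
        unfolding S_def by (intro sum.cong refl) (simp add: iff indicator_def)
      then show ?thesis by (simp add: Int_def)
    qed
    have cnt_ge: "S N - real n \<le> real (cnt N)" for N
    proof -
      have "card {i. i < N \<and> block_end (i + n)} = card ((\<lambda>i. i + n) ` {i. i < N \<and> block_end (i + n)})"
        by (rule card_image[symmetric]) (simp add: inj_on_def)
      also have "\<dots> \<le> card ({j\<in>{1..N}. block_end j} \<union> {N<..N + n})"
        using n1 by (intro card_mono) auto
      also have "\<dots> \<le> cnt N + card {N<..N + n}" unfolding cnt_def by (rule card_Un_le)
      finally show ?thesis unfolding S_eq by simp
    qed
    have strategy: "exp (\<gamma> * real (cnt N) - \<eta> * real N) \<le> Z v N" if "block_end N" for N
      unfolding \<gamma>_def cnt_def block_end_def n
    proof (rule rare_block_strategy[where e = e and b = b])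
      show "v i = e" if "i \<in> G" for i using that by (simp add: v_def weights_def G_def)
      show "n0 + L \<le> N \<and> {N - (n0 + L)<..N} \<subseteq> G" using that by (simp add: block_end_def n)
    qed (use assms in auto)
    show "\<gamma> * p - \<eta> \<le> F \<beta> (- \<beta> + e)"
    proof (rule ccontr)
      assume "\<not> ?thesis"
      then obtain x where x: "F \<beta> (- \<beta> + e) < x" "x < \<gamma> * p - \<eta>" using dense by (auto simp: not_le)
      have "(\<lambda>N. \<gamma> * (S N / real N - real n / real N) - \<eta>) \<longlonglongrightarrow> \<gamma> * (p - 0) - \<eta>"
        by (intro tendsto_intros S_lim lim_const_over_n)
      then have "eventually (\<lambda>N. x < \<gamma> * (S N / real N - real n / real N) - \<eta>) sequentially"
        using x by (intro order_tendstoD(1)) auto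
      moreover have "eventually (\<lambda>N. ln (Z v N) / real N < x) sequentially"
        using x F_lim by (intro order_tendstoD(2)) auto
      ultimately have "eventually (\<lambda>N. \<not> block_end N) sequentially"
        using eventually_ge_at_top[of n0]
      proof eventually_elim
        case (elim N)
        have N: "real N > 0" using elim n0_ge_1 by simp
        show ?case
        proof
          assume "block_end N"
          then have "ln (exp (\<gamma> * real (cnt N) - \<eta> * real N)) \<le> ln (Z v N)"
            using strategy[of N] Z_pos[OF elim(3), of v] by (subst ln_le_cancel_iff) auto
          moreover have "\<gamma> * (S N - real n) \<le> \<gamma> * real (cnt N)" using cnt_ge \<gamma> by (intro mult_left_mono)
          ultimately have "(\<gamma> * (S N - real n) - \<eta> * real N) / real N \<le> ln (Z v N) / real N"
            using N by (intro divide_right_mono) auto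
          moreover have "(\<gamma> * (S N - real n) - \<eta> * real N) / real N = \<gamma> * (S N / real N - real n / real N) - \<eta>"
            using N by (simp add: field_simps)
          ultimately show False using elim by linarith
        qed
      qed
      \<comment> \<open>The strategy controls the partition function only where a block ends, but blocks end
        infinitely often because they have positive frequency.\<close>
      then obtain m where m: "\<And>N. N \<ge> m \<Longrightarrow> \<not> block_end N" by (auto simp: eventually_sequentially)
      have "S N \<le> real m" for N
      proof -
        have "{i. i < N \<and> block_end (i + n)} \<subseteq> {..<m}" using m by (force simp: not_le[symmetric])
        then have "card {i. i < N \<and> block_end (i + n)} \<le> card {..<m}" by (intro card_mono) auto
        then show ?thesis unfolding S_eq by simp
      qed
      then have "S N / real N \<le> real m / real N" for N by (intro divide_right_mono) auto
      then have "p \<le> 0" by (intro LIMSEQ_le[OF S_lim lim_const_over_n]) auto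
      then show False using assms(8) by (simp add: p_def)
    qed
  qed
  then show ?thesis by (simp add: \<gamma>_def p_def)
qed

text \<open>
  The block length \<open>n'\<close> provided by infinite disorder is rounded down to \<open>n0 + k * m\<close>, so that the
  last \<open>k * m\<close> sites of a block consist of \<open>k\<close> periods with gain \<open>g\<close> each.  The constant \<open>T\<close> collects the
  part of the jump cost that does not grow with \<open>k\<close>.
\<close>
lemma infinite_disorder_localizes:
  assumes dis: "infinite_disorder P \<omega>" and \<beta>: "\<beta> > 0" and e: "e > 0"
  shows "F \<beta> (- \<beta> + e) > 0"
proof -
  obtain m where m: "m \<ge> 1" "Z (\<lambda>_. e) m > 1" using homogeneous_gain[OF e] by blast
  define g where "g = ln (Z (\<lambda>_. e) m)"
  have g: "g > 0" using m by (simp add: g_def)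
  \<comment> \<open>Per period, the jump cost \<open>(1 + \<alpha>) * 2 * \<delta> * m\<close> is then half of the gain.\<close>
  define \<delta> where "\<delta> = g / (4 * (1 + \<alpha>) * real m)"
  have \<delta>: "\<delta> > 0" using g m \<alpha>_pos by (simp add: \<delta>_def)
  have \<delta>_eq: "(1 + \<alpha>) * (2 * \<delta> * real m) = g / 2"
  proof -
    have "\<delta> * (4 * (1 + \<alpha>) * real m) = g" using m \<alpha>_pos by (simp add: \<delta>_def)
    then show ?thesis by (simp add: mult_ac)
  qed
  define T where "T = (1 + \<alpha>) * (2 * \<delta> * real n0 - ln \<delta> + 1) - ln c"
  obtain k1 where k1: "real k1 * (g / 2) > T" using reals_Archimedean3[of "g / 2"] g by auto
  obtain n' where n': "n' \<ge> n0 + (k1 + 1) * m" "exp (- (\<delta> / 2 * real n')) \<le> env.plus_prob {1..n'}"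
    using env.infinite_disorderD[OF dis, of "\<delta> / 2"] \<delta> by auto
  define k where "k = (n' - n0) div m"
  define n where "n = n0 + k * m"
  define p where "p = env.plus_prob {1..n}"
  have k: "k \<ge> k1 + 1"
  proof -
    have "(k1 + 1) * m div m \<le> k" unfolding k_def using n' by (intro div_le_mono) simp
    then show ?thesis using m by simp
  qed
  have n_le: "n \<le> n'"
  proof -
    have "k * m \<le> n' - n0" by (simp add: k_def)
    then show ?thesis using n'(1) by (simp add: n_def)
  qed
  have n'_less: "n' \<le> 2 * n"
  proof -
    define t where "t = k * m"
    have "n' - n0 < t + m" unfolding k_def t_def
      using m dividend_less_div_times[of m "n' - n0"] by (simp add: mult.commute)
    moreover have "m \<le> t" using k by (simp add: t_def)
    moreover have "n = n0 + t" by (simp add: n_def t_def)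
    ultimately show ?thesis by linarith
  qed
  have "n \<ge> 1" using n0_ge_1 by (simp add: n_def)
  then have n_pos: "real n > 0" by simp
  have p_ge: "exp (- (\<delta> * real n)) \<le> p"
  proof -
    have "\<delta> / 2 * real n' \<le> \<delta> / 2 * real (2 * n)" using n'_less \<delta> by (intro mult_left_mono) linarith+
    then have "exp (- (\<delta> * real n)) \<le> exp (- (\<delta> / 2 * real n'))" by simp
    also have "\<dots> \<le> env.plus_prob {1..n'}" by (rule n')
    also have "\<dots> \<le> p" unfolding p_def using n_le by (intro env.plus_prob_antimono) auto
    finally show ?thesis .
  qed
  have p: "0 < p" using p_ge by (rule less_le_trans[rotated]) simp
  \<comment> \<open>The typical distance between disjoint blocks.\<close>
  define A where "A = real n / p"
  have A: "A > 0" using p n_pos by (simp add: A_def)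
  define b where "b = (1 + \<alpha>) * ln A - ln c"
  have b_less: "b + (1 + \<alpha>) < real k * g"
  proof -
    have "ln (exp (- (\<delta> * real n))) \<le> ln p" using p_ge p by (subst ln_le_cancel_iff) auto
    then have "- ln p \<le> \<delta> * real n" by simp
    moreover have "ln (\<delta> * real n) \<le> \<delta> * real n - 1" using \<delta> n_pos by (intro ln_le_minus_one) simp
    then have "ln (real n) \<le> \<delta> * real n - ln \<delta>" using \<delta> n_pos by (simp add: ln_mult)
    moreover have "ln A = ln (real n) - ln p" unfolding A_def using p n_pos by (simp add: ln_div)
    ultimately have "ln A \<le> 2 * \<delta> * real n - ln \<delta>" by simp
    then have "(1 + \<alpha>) * ln A \<le> (1 + \<alpha>) * (2 * \<delta> * real n - ln \<delta>)"
      using \<alpha>_pos by (intro mult_left_mono) auto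
    then have "b + (1 + \<alpha>) \<le> (1 + \<alpha>) * (2 * \<delta> * real n - ln \<delta> + 1) - ln c"
      by (simp add: b_def distrib_left)
    also have "\<dots> = T + real k * ((1 + \<alpha>) * (2 * \<delta> * real m))"
      by (simp add: T_def n_def algebra_simps)
    also have "\<dots> < real k * (g / 2) + real k * (g / 2)"
    proof -
      have "real k1 * (g / 2) \<le> real k * (g / 2)" using k g by (intro mult_right_mono) auto
      then show ?thesis using k1 unfolding \<delta>_eq by linarith
    qed
    finally show ?thesis by (simp add: mult.commute)
  qed
  have "(real k * g - b) / real n * env.plus_prob {1..n} - (1 + \<alpha>) / A \<le> F \<beta> (- \<beta> + e)"
  proof (rule rare_block_free_energy[where L = "k * m"])
    have "exp (real k * g) = Z (\<lambda>_. e) m ^ k" using m by (simp add: exp_of_nat_mult g_def)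
    then show "exp (real k * g) \<le> Z (\<lambda>_. e) (k * m)" using Z_power[of e m k] by simp
    show "exp (- b - (1 + \<alpha>) / A * real j) \<le> K j" if "j \<ge> n0" for j
      using ln_K_lower[OF that A] by (simp add: b_def)
    show "b \<le> real k * g" using b_less \<alpha>_pos by linarith
    show "0 \<le> (1 + \<alpha>) / A" using A \<alpha>_pos by simp
  qed (use \<beta> e p n_def p_def in auto)
  moreover have "(real k * g - b) / real n * env.plus_prob {1..n} - (1 + \<alpha>) / A
      = p / real n * (real k * g - b - (1 + \<alpha>))"
    unfolding p_def[symmetric] using p n_pos by (simp add: A_def field_simps)
  moreover have "\<dots> > 0" using b_less p n_pos by (intro mult_pos_pos) auto
  ultimately show ?thesis by linarith
qed

end

theorem theorem1p6:
  fixes M :: "'a measure" and \<tau> :: "nat \<Rightarrow> 'a \<Rightarrow> nat" and K :: "nat \<Rightarrow> real"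
    and \<alpha> c\<^sub>K :: real
    and P :: "'b measure" and \<omega> :: "nat \<Rightarrow> 'b \<Rightarrow> real"
  assumes renewal: "renewal_process M \<tau> K"
    and alpha: "\<alpha> > 0" "\<alpha> \<noteq> 1"
    and cK: "c\<^sub>K > 0"
    and tail: "K \<sim>[at_top] (\<lambda>n. c\<^sub>K * real n powr (-(1 + \<alpha>)))"
    and environment: "stationary_ergodic P \<omega>"
    and spins: "\<And>i y. y \<in> space P \<Longrightarrow> \<omega> i y \<in> {-1, 1}"
    and nontrivial: "measure P {y\<in>space P. \<omega> 1 y = 1} > 0"
      "measure P {y\<in>space P. \<omega> 1 y = -1} > 0"
    and correlations: "nonincreasing_correlations P \<omega>"
  shows "(\<forall>\<beta>>0. critical_point M \<tau> P \<omega> \<beta> = -\<beta>) \<longleftrightarrow> infinite_disorder P \<omega>"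
proof -
  obtain n0 :: nat and c :: real where nc: "n0 \<ge> 1" "c > 0"
    "\<And>n. n \<ge> n0 \<Longrightarrow> c * real n powr (-(1 + \<alpha>)) \<le> K n"
    by (rule regular_tail_lower_bound[OF tail cK]) blast
  interpret pinning_model M \<tau> K n0 c \<alpha> P \<omega>
  proof (intro pinning_model.intro pinning.intro renewal.intro pinning_axioms.intro
      environment.intro environment_axioms.intro)
    show "prob_space P" using environment by (simp add: stationary_ergodic_def)
  qed (use assms nc in auto)
  show ?thesis
  proof
    assume crit: "\<forall>\<beta>>0. critical_point M \<tau> P \<omega> \<beta> = -\<beta>"
    show "infinite_disorder P \<omega>"
    proof (rule ccontr)
      assume "\<not> infinite_disorder P \<omega>"
      then obtain \<rho> C where \<rho>: "0 < \<rho>" "\<rho> < 1" "\<And>n. env.plus_prob {1..n} \<le> C * \<rho> ^ n"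
        using env.not_infinite_disorderD by blast
      have "env.plus_prob E \<le> C * \<rho> ^ card E" if "finite E" "E \<subseteq> {1..}" for E
      proof -
        have "env.plus_prob ({1..0} \<union> E) \<le> env.plus_prob {1..0 + card E}"
          using that by (intro env.plus_prob_prefix correlations) auto
        then show ?thesis using \<rho>(3)[of "card E"] by simp
      qed
      then obtain \<beta> h where "\<beta> > 0" "h > - \<beta>" "F \<beta> h \<le> 0"
        using exponential_decay_shifts_critical_point[OF \<rho>(1,2)] by blast
      then show False using critical_point_iff[of \<beta> h] crit by auto
    qed
  next
    assume dis: "infinite_disorder P \<omega>"
    show "\<forall>\<beta>>0. critical_point M \<tau> P \<omega> \<beta> = -\<beta>"
    proof (intro allI impI)
      fix \<beta> :: real assume \<beta>: "\<beta> > 0"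
      define hc where "hc = critical_point M \<tau> P \<omega> \<beta>"
      have "\<not> hc < - \<beta>"
        using F_nonpos[of \<beta> "- \<beta>"] critical_point_iff[of \<beta> "- \<beta>"] \<beta> by (simp add: hc_def)
      moreover have "\<not> - \<beta> < hc"
        using infinite_disorder_localizes[OF dis \<beta>, of "hc + \<beta>"] critical_point_iff[of \<beta> hc] \<beta>
        by (auto simp: hc_def)
      ultimately show "critical_point M \<tau> P \<omega> \<beta> = - \<beta>" by (simp add: hc_def)
    qed
  qed
qed

end
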